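(* Let $D$ be a distributive lattice with zero, and let $\langle L,\varphi\rangle$ be an internally saturated $D$-measured lattice. Then the following assertions hold: 1. $L$ is relatively complemented. 2. The map $\varphi$ is an isomorphism from $\mathrm{Con}_cL$ onto an ideal of $D$. 3. For all $o,a,b,i\in L$ such that $o\le a\le i$ and $o\le b\le i$, $\Theta_L(o,a)=\Theta_L(o,b)$ if and only if there are $a_0,a_1,b_0,b_1\in[o,i]$ such that (a) $a=a_0\oplus a_1$ and $b=b_0\oplus b_1$ in $[o,i]$; (b) $a_0$ and $b_0$ are perspective in $[o,i]$, and $a_1$ and $b_1$ are perspective in $[o,i]$. 4. If, in addition, $\langle L,\varphi\rangle$ is either lower saturated or upper saturated, then $\varphi$ is an isomorphism from $\mathrm{Con}_cL$ onto $D$.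
   Context: **Partial lattices.** $[X]^{<\omega}_*$ is the set of nonempty finite subsets of $X$. For a preordering $\le$ on $P$, "$a=\sup X$" means that $x\le a$ for all $x\in X$ and that $a\le b$ whenever $x\le b$ for all $x\in X$; $\inf$ is dual. A *partial prelattice* is $\langle P,\le,\bigvee,\bigwedge\rangle$ with $P$ a nonempty set, $\le$ a preordering on $P$, and $\bigvee,\bigwedge$ partial functions from $[P]^{<\omega}_*$ to $P$ such that $a=\bigvee X$ implies $a=\sup X$ and $a=\bigwedge X$ implies $a=\inf X$. It is a *partial lattice* if $\le$ is antisymmetric. Lattices are identified with partial lattices in which $\bigvee,\bigwedge$ are defined on all of $[P]^{<\omega}_*$. A *homomorphism* of partial lattices is an order-preserving map $f$ such that $a=\bigvee X$ implies $f(a)=\bigvee f[X]$ and $a=\bigwedge X$ implies $f(a)=\bigwedge f[X]$; it is an *embedding* if moreover $f(a)\le f(b)$ implies $a\le b$. **Congruences.** A *congruence* of a partial lattice $P$ is a preordering $\preceq$ of $P$ containing $\le$ such that $\langle P,\preceq,\bigvee,\bigwedge\rangle$ is a partial prelattice. (For a lattice this is equivalent to the usual notion.) Ordered by inclusion the congruences form an algebraic lattice; $\mathrm{Con}_c\,P$ is the $\{\vee,0\}$-semilattice of its compact elements, with zero $\mathbf 0_P$ (the ordering of $P$). $\Theta_P(a,b)$ is the least congruence containing both $\langle a,b\rangle$ and $\langle b,a\rangle$. For a homomorphism $f\colon P\to Q$, $\mathrm{Con}_c f$ sends $\alpha\in\mathrm{Con}_cP$ to the congruence of $Q$ generated by all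 $\langle f(x),f(y)\rangle$ with $\langle x,y\rangle\in\alpha$. **Measured partial lattices.** A *$D$-measured partial lattice* is a pair $\langle P,\varphi\rangle$ with $P$ a partial lattice and $\varphi\colon\mathrm{Con}_cP\to D$ a $\{\vee,0\}$-homomorphism; it is a *$D$-measured lattice* if $P$ is a lattice, *finite* if $P$ is finite, and *proper* if $\varphi(\theta)=0$ implies $\theta=\mathbf 0_P$. A homomorphism (resp., embedding) $\langle P,\mu\rangle\to\langle Q,\nu\rangle$ is a homomorphism (resp., embedding) $f\colon P\to Q$ of partial lattices with $\nu\circ\mathrm{Con}_cf=\mu$. **Saturation.** Let $e\colon\langle K,\lambda\rangle\hookrightarrow\langle P,\mu\rangle$ be an embedding of finite proper $D$-measured partial lattices with $K$ a lattice. It is a *lower* (resp., *upper*, *internal* ) embedding if the filter (resp., ideal, convex sub-partial-lattice) of $P$ generated by $e[K]$ is $P$; since $K$ is a finite lattice with bounds $0_K,1_K$, this means $e(0_K)\le x$ (resp., $x\le e(1_K)$, $e(0_K)\le x\le e(1_K)$) for all $x\in P$. A proper $D$-measured lattice $\langle L,\varphi\rangle$ is *lower saturated* (resp., *upper saturated*, *internally saturated* ) if for every lower (resp., upper, internal) embedding $e\colon\langle K,\lambda\rangle\hookrightarrow\langle P,\mu\rangle$ of finite proper $D$-measured partial lattices with $K$ a lattice, and every homomorphism $f\colon\langle K,\lambda\rangle\to\langle L,\varphi\rangle$, there is a homomorphism $g\colon\langle P,\mu\rangle\to\langle L,\varphi\rangle$ with $g\circ e=f$. **Other notation.** For $x,y\in[o,i]$,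 "$c=x\oplus y$ in $[o,i]$" means $x\wedge y=o$ and $x\vee y=c$. Elements $x,y\in[o,i]$ are *perspective in $[o,i]$* if there is $z\in[o,i]$ with $z\wedge x=z\wedge y$ and $z\vee x=z\vee y$. *)

theory Defs
  imports Main
begin

section \<open>Partial lattices\<close>

record 'a plat =
  pcarrier :: "'a set"
  ple :: "'a rel"
  pjoin :: "'a set \<Rightarrow> 'a option"
  pmeet :: "'a set \<Rightarrow> 'a option"

definition is_sup :: "'a set \<Rightarrow> 'a rel \<Rightarrow> 'a set \<Rightarrow> 'a \<Rightarrow> bool" where
  "is_sup P r X a \<longleftrightarrow> a \<in> P \<and> (\<forall>x\<in>X. (x, a) \<in> r) \<and>
     (\<forall>b\<in>P. (\<forall>x\<in>X. (x, b) \<in> r) \<longrightarrow> (a, b) \<in> r)"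

definition is_inf :: "'a set \<Rightarrow> 'a rel \<Rightarrow> 'a set \<Rightarrow> 'a \<Rightarrow> bool" where
  "is_inf P r X a \<longleftrightarrow> a \<in> P \<and> (\<forall>x\<in>X. (a, x) \<in> r) \<and>
     (\<forall>b\<in>P. (\<forall>x\<in>X. (b, x) \<in> r) \<longrightarrow> (b, a) \<in> r)"

definition fin_subsets :: "'a set \<Rightarrow> 'a set set" where
  "fin_subsets P = {X. X \<subseteq> P \<and> finite X \<and> X \<noteq> {}}"

definition partial_prelattice :: "'a plat \<Rightarrow> bool" where
  "partial_prelattice P \<longleftrightarrow>
     pcarrier P \<noteq> {} \<and> preorder_on (pcarrier P) (ple P) \<and>
     (\<forall>X a. pjoin P X = Some a \<longrightarrow>
        X \<in> fin_subsets (pcarrier P) \<and> is_sup (pcarrier P) (ple P) X a) \<and>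
     (\<forall>X a. pmeet P X = Some a \<longrightarrow>
        X \<in> fin_subsets (pcarrier P) \<and> is_inf (pcarrier P) (ple P) X a)"

definition partial_lattice :: "'a plat \<Rightarrow> bool" where
  "partial_lattice P \<longleftrightarrow> partial_prelattice P \<and> antisym (ple P)"

definition total_lattice :: "'a plat \<Rightarrow> bool" where
  "total_lattice L \<longleftrightarrow> partial_lattice L \<and>
     (\<forall>X\<in>fin_subsets (pcarrier L). pjoin L X \<noteq> None \<and> pmeet L X \<noteq> None)"

text \<open>The following four operations are only meaningful for lattices
  (the bounds only for finite ones).\<close>

definition lsup :: "'a plat \<Rightarrow> 'a \<Rightarrow> 'a \<Rightarrow> 'a" where
  "lsup L x y = the (pjoin L {x, y})"

definition linf :: "'a plat \<Rightarrow> 'a \<Rightarrow> 'a \<Rightarrow> 'a" where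
  "linf L x y = the (pmeet L {x, y})"

definition lbot :: "'a plat \<Rightarrow> 'a" where
  "lbot K = (THE z. z \<in> pcarrier K \<and> (\<forall>x\<in>pcarrier K. (z, x) \<in> ple K))"

definition ltop :: "'a plat \<Rightarrow> 'a" where
  "ltop K = (THE z. z \<in> pcarrier K \<and> (\<forall>x\<in>pcarrier K. (x, z) \<in> ple K))"

definition plat_hom :: "'a plat \<Rightarrow> 'b plat \<Rightarrow> ('a \<Rightarrow> 'b) \<Rightarrow> bool" where
  "plat_hom P Q f \<longleftrightarrow>
     f ` pcarrier P \<subseteq> pcarrier Q \<and>
     (\<forall>x y. (x, y) \<in> ple P \<longrightarrow> (f x, f y) \<in> ple Q) \<and>
     (\<forall>X a. pjoin P X = Some a \<longrightarrow> pjoin Q (f ` X) = Some (f a)) \<and>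
     (\<forall>X a. pmeet P X = Some a \<longrightarrow> pmeet Q (f ` X) = Some (f a))"

definition plat_embedding :: "'a plat \<Rightarrow> 'b plat \<Rightarrow> ('a \<Rightarrow> 'b) \<Rightarrow> bool" where
  "plat_embedding P Q f \<longleftrightarrow> plat_hom P Q f \<and>
     (\<forall>x\<in>pcarrier P. \<forall>y\<in>pcarrier P. (f x, f y) \<in> ple Q \<longrightarrow> (x, y) \<in> ple P)"


section \<open>Congruences\<close>

definition Con :: "'a plat \<Rightarrow> 'a rel set" where
  "Con P = {r. ple P \<subseteq> r \<and> partial_prelattice (P\<lparr>ple := r\<rparr>)}"

text \<open>The congruence generated by \<open>R \<subseteq> P \<times> P\<close>. The set of congruences containing \<open>R\<close>
  is nonempty, since \<open>P \<times> P\<close> is a congruence, and it is closed under nonempty intersections.\<close>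

definition cgen :: "'a plat \<Rightarrow> 'a rel \<Rightarrow> 'a rel" where
  "cgen P R = \<Inter>{r \<in> Con P. R \<subseteq> r}"

definition Theta :: "'a plat \<Rightarrow> 'a \<Rightarrow> 'a \<Rightarrow> 'a rel" where
  "Theta P a b = cgen P {(a, b), (b, a)}"

text \<open>Compact elements of the complete lattice \<open>Con P\<close>, where the join of \<open>S \<subseteq> Con P\<close> is
  \<open>cgen P (\<Union>S)\<close>.\<close>

definition Con_c :: "'a plat \<Rightarrow> 'a rel set" where
  "Con_c P = {r \<in> Con P. \<forall>S. S \<subseteq> Con P \<longrightarrow> r \<subseteq> cgen P (\<Union>S) \<longrightarrow>
     (\<exists>F. finite F \<and> F \<subseteq> S \<and> r \<subseteq> cgen P (\<Union>F))}"

definition Con_c_map :: "'b plat \<Rightarrow> ('a \<Rightarrow> 'b) \<Rightarrow> 'a rel \<Rightarrow> 'b rel" where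
  "Con_c_map Q f r = cgen Q {(f x, f y) | x y. (x, y) \<in> r}"


section \<open>Measured partial lattices\<close>

text \<open>The target \<open>D\<close> is the universe of a type; only the values of a measure on
  \<open>Con_c P\<close> are relevant.\<close>

definition con_c_hom :: "'a plat \<Rightarrow> ('a rel \<Rightarrow> 'd::{distrib_lattice, order_bot}) \<Rightarrow> bool" where
  "con_c_hom P \<phi> \<longleftrightarrow> \<phi> (ple P) = bot \<and>
     (\<forall>r\<in>Con_c P. \<forall>s\<in>Con_c P. \<phi> (cgen P (r \<union> s)) = sup (\<phi> r) (\<phi> s))"

definition measured_plat :: "'a plat \<Rightarrow> ('a rel \<Rightarrow> 'd::{distrib_lattice, order_bot}) \<Rightarrow> bool" where
  "measured_plat P \<phi> \<longleftrightarrow> partial_lattice P \<and> con_c_hom P \<phi>"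

definition proper_measure :: "'a plat \<Rightarrow> ('a rel \<Rightarrow> 'd::{distrib_lattice, order_bot}) \<Rightarrow> bool" where
  "proper_measure P \<phi> \<longleftrightarrow> (\<forall>r\<in>Con_c P. \<phi> r = bot \<longrightarrow> r = ple P)"

definition measure_preserving :: "'a plat \<Rightarrow> ('a rel \<Rightarrow> 'd::{distrib_lattice, order_bot}) \<Rightarrow>
    'b plat \<Rightarrow> ('b rel \<Rightarrow> 'd) \<Rightarrow> ('a \<Rightarrow> 'b) \<Rightarrow> bool" where
  "measure_preserving P \<mu> Q \<nu> f \<longleftrightarrow> (\<forall>r\<in>Con_c P. \<nu> (Con_c_map Q f r) = \<mu> r)"

definition measured_hom :: "'a plat \<Rightarrow> ('a rel \<Rightarrow> 'd::{distrib_lattice, order_bot}) \<Rightarrow>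
    'b plat \<Rightarrow> ('b rel \<Rightarrow> 'd) \<Rightarrow> ('a \<Rightarrow> 'b) \<Rightarrow> bool" where
  "measured_hom P \<mu> Q \<nu> f \<longleftrightarrow> plat_hom P Q f \<and> measure_preserving P \<mu> Q \<nu> f"

definition measured_embedding :: "'a plat \<Rightarrow> ('a rel \<Rightarrow> 'd::{distrib_lattice, order_bot}) \<Rightarrow>
    'b plat \<Rightarrow> ('b rel \<Rightarrow> 'd) \<Rightarrow> ('a \<Rightarrow> 'b) \<Rightarrow> bool" where
  "measured_embedding P \<mu> Q \<nu> f \<longleftrightarrow> plat_embedding P Q f \<and> measure_preserving P \<mu> Q \<nu> f"


section \<open>Saturation\<close>

text \<open>Since \<open>K\<close> is a finite lattice, the filter (resp., ideal, convex sub-partial-lattice) of \<open>P\<close>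
  generated by \<open>e ` K\<close> is all of \<open>P\<close> iff the image of the bottom (resp., top, both bounds) of
  \<open>K\<close> bounds \<open>P\<close>.\<close>

definition lower_map :: "'a plat \<Rightarrow> 'b plat \<Rightarrow> ('a \<Rightarrow> 'b) \<Rightarrow> bool" where
  "lower_map K P e \<longleftrightarrow> (\<forall>x\<in>pcarrier P. (e (lbot K), x) \<in> ple P)"

definition upper_map :: "'a plat \<Rightarrow> 'b plat \<Rightarrow> ('a \<Rightarrow> 'b) \<Rightarrow> bool" where
  "upper_map K P e \<longleftrightarrow> (\<forall>x\<in>pcarrier P. (x, e (ltop K)) \<in> ple P)"

definition internal_map :: "'a plat \<Rightarrow> 'b plat \<Rightarrow> ('a \<Rightarrow> 'b) \<Rightarrow> bool" where
  "internal_map K P e \<longleftrightarrow> lower_map K P e \<and> upper_map K P e"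

text \<open>The test objects \<open>K\<close> and \<open>P\<close> are finite, so up to isomorphism their carriers may be
  taken to be (arbitrary finite) sets of natural numbers; this avoids quantification over
  types. The parameter \<open>B\<close> is the class of admissible embeddings.\<close>

definition saturated_wrt :: "(nat plat \<Rightarrow> nat plat \<Rightarrow> (nat \<Rightarrow> nat) \<Rightarrow> bool) \<Rightarrow>
    'a plat \<Rightarrow> ('a rel \<Rightarrow> 'd::{distrib_lattice, order_bot}) \<Rightarrow> bool" where
  "saturated_wrt B L \<phi> \<longleftrightarrow>
     total_lattice L \<and> measured_plat L \<phi> \<and> proper_measure L \<phi> \<and>
     (\<forall>K \<kappa> P \<mu> e f.
        finite (pcarrier K) \<and> total_lattice K \<and> measured_plat K \<kappa> \<and> proper_measure K \<kappa> \<and>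
        finite (pcarrier P) \<and> measured_plat P \<mu> \<and> proper_measure P \<mu> \<and>
        measured_embedding K \<kappa> P \<mu> e \<and> B K P e \<and>
        measured_hom K \<kappa> L \<phi> f \<longrightarrow>
        (\<exists>g. measured_hom P \<mu> L \<phi> g \<and> (\<forall>x\<in>pcarrier K. g (e x) = f x)))"

definition lower_saturated :: "'a plat \<Rightarrow> ('a rel \<Rightarrow> 'd::{distrib_lattice, order_bot}) \<Rightarrow> bool" where
  "lower_saturated = saturated_wrt lower_map"

definition upper_saturated :: "'a plat \<Rightarrow> ('a rel \<Rightarrow> 'd::{distrib_lattice, order_bot}) \<Rightarrow> bool" where
  "upper_saturated = saturated_wrt upper_map"

definition internally_saturated :: "'a plat \<Rightarrow> ('a rel \<Rightarrow> 'd::{distrib_lattice, order_bot}) \<Rightarrow> bool" where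
  "internally_saturated = saturated_wrt internal_map"


section \<open>Intervals, complements, perspectivity, ideals\<close>

definition linterval :: "'a plat \<Rightarrow> 'a \<Rightarrow> 'a \<Rightarrow> 'a set" where
  "linterval L u v = {x \<in> pcarrier L. (u, x) \<in> ple L \<and> (x, v) \<in> ple L}"

definition relatively_complemented :: "'a plat \<Rightarrow> bool" where
  "relatively_complemented L \<longleftrightarrow>
     (\<forall>u\<in>pcarrier L. \<forall>v\<in>pcarrier L. \<forall>x\<in>linterval L u v.
        \<exists>y\<in>linterval L u v. linf L x y = u \<and> lsup L x y = v)"

text \<open>\<open>c = x \<oplus> y\<close> in \<open>[u, v]\<close>\<close>

definition direct_sum_in :: "'a plat \<Rightarrow> 'a \<Rightarrow> 'a \<Rightarrow> 'a \<Rightarrow> 'a \<Rightarrow> 'a \<Rightarrow> bool" where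
  "direct_sum_in L u v c x y \<longleftrightarrow>
     x \<in> linterval L u v \<and> y \<in> linterval L u v \<and> linf L x y = u \<and> lsup L x y = c"

definition perspective_in :: "'a plat \<Rightarrow> 'a \<Rightarrow> 'a \<Rightarrow> 'a \<Rightarrow> 'a \<Rightarrow> bool" where
  "perspective_in L u v x y \<longleftrightarrow>
     x \<in> linterval L u v \<and> y \<in> linterval L u v \<and>
     (\<exists>z\<in>linterval L u v. linf L z x = linf L z y \<and> lsup L z x = lsup L z y)"

definition lattice_ideal :: "'d::{distrib_lattice, order_bot} set \<Rightarrow> bool" where
  "lattice_ideal I \<longleftrightarrow> I \<noteq> {} \<and> (\<forall>x\<in>I. \<forall>y. y \<le> x \<longrightarrow> y \<in> I) \<and>
     (\<forall>x\<in>I. \<forall>y\<in>I. sup x y \<in> I)"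

definition con_c_iso_onto ::
    "'a plat \<Rightarrow> ('a rel \<Rightarrow> 'd::{distrib_lattice, order_bot}) \<Rightarrow> 'd set \<Rightarrow> bool" where
  "con_c_iso_onto L \<phi> I \<longleftrightarrow> con_c_hom L \<phi> \<and> bij_betw \<phi> (Con_c L) I"

end

theory Submission
  imports Defs
begin

text \<open>Congruences being preorders, the basic object is the one-sided principal congruence
  \<open>cg x y\<close>, the least congruence that puts \<open>x\<close> below \<open>y\<close>; write \<open>v x y\<close> for its measure. Internal
  saturation is needed for three test embeddings only. The two-element chain in the three-element
  chain splits an interval along any decomposition of its measure; the three-element chain in the
  square gives relative complements; the square in \<open>M\<^sub>3\<close> makes \<open>x\<close> and \<open>y\<close> perspective as soon as
  they have the same measure over \<open>x \<and> y\<close>.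

  If \<open>v x u \<le> v y u\<close> with \<open>u \<le> x, y\<close>, replace \<open>x\<close> by a complement \<open>x'\<close> of \<open>x \<and> y\<close> in \<open>[u, x]\<close> and
  split off from \<open>y\<close> an element \<open>y'\<close> with the measure of \<open>x'\<close>; then \<open>x'\<close> and \<open>y'\<close> are perspective,
  so that \<open>cg x u \<subseteq> cg y u\<close>. Together with splitting and distributivity of \<open>D\<close> this shows
  that the measure reflects inclusion and that its range is an ideal.\<close>

section \<open>Congruences generated by pairs\<close>

lemma partial_prelatticeD:
  assumes "partial_prelattice P"
  shows "ple P \<subseteq> pcarrier P \<times> pcarrier P"
    and "x \<in> pcarrier P \<Longrightarrow> (x, x) \<in> ple P"
    and "trans (ple P)"
    and "pjoin P X = Some a \<Longrightarrow> X \<in> fin_subsets (pcarrier P)"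
    and "pjoin P X = Some a \<Longrightarrow> is_sup (pcarrier P) (ple P) X a"
    and "pmeet P X = Some a \<Longrightarrow> X \<in> fin_subsets (pcarrier P)"
    and "pmeet P X = Some a \<Longrightarrow> is_inf (pcarrier P) (ple P) X a"
  using assms unfolding partial_prelattice_def preorder_on_def refl_on_def by blast+

lemma ConI:
  assumes "partial_prelattice P" "ple P \<subseteq> r" "preorder_on (pcarrier P) r"
    and "\<And>X a. pjoin P X = Some a \<Longrightarrow> is_sup (pcarrier P) r X a"
    and "\<And>X a. pmeet P X = Some a \<Longrightarrow> is_inf (pcarrier P) r X a"
  shows "r \<in> Con P"
  using assms by (simp add: Con_def partial_prelattice_def)

lemma ConD:
  assumes "r \<in> Con P"
  shows "ple P \<subseteq> r"
    and "preorder_on (pcarrier P) r"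
    and "r \<subseteq> pcarrier P \<times> pcarrier P"
    and "x \<in> pcarrier P \<Longrightarrow> (x, x) \<in> r"
    and "trans r"
    and "pjoin P X = Some a \<Longrightarrow> is_sup (pcarrier P) r X a"
    and "pmeet P X = Some a \<Longrightarrow> is_inf (pcarrier P) r X a"
  using assms by (simp_all add: Con_def partial_prelattice_def preorder_on_def refl_on_def)

lemma ple_in_Con: "partial_prelattice P \<Longrightarrow> ple P \<in> Con P"
  by (simp add: Con_def)

lemma full_in_Con:
  assumes P: "partial_prelattice P"
  shows "pcarrier P \<times> pcarrier P \<in> Con P"
proof (rule ConI[OF P])
  show "ple P \<subseteq> pcarrier P \<times> pcarrier P"
    by (rule partial_prelatticeD(1)[OF P])
  show "preorder_on (pcarrier P) (pcarrier P \<times> pcarrier P)"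
    by (auto simp: preorder_on_def refl_on_def intro: transI)
  show "is_sup (pcarrier P) (pcarrier P \<times> pcarrier P) X a" if "pjoin P X = Some a" for X a
    using partial_prelatticeD(4,5)[OF P that] by (auto simp: is_sup_def fin_subsets_def)
  show "is_inf (pcarrier P) (pcarrier P \<times> pcarrier P) X a" if "pmeet P X = Some a" for X a
    using partial_prelatticeD(6,7)[OF P that] by (auto simp: is_inf_def fin_subsets_def)
qed

lemma subset_cgen: "R \<subseteq> cgen P R"
  by (auto simp: cgen_def)

lemma cgen_least: "r \<in> Con P \<Longrightarrow> R \<subseteq> r \<Longrightarrow> cgen P R \<subseteq> r"
  by (auto simp: cgen_def)

lemma cgen_mono: "R \<subseteq> S \<Longrightarrow> cgen P R \<subseteq> cgen P S"
  by (auto simp: cgen_def)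

lemma cgen_Con: "r \<in> Con P \<Longrightarrow> cgen P r = r"
  by (simp add: cgen_least subset_cgen subset_antisym)

lemma cgen_iff: "p \<in> cgen P R \<longleftrightarrow> (\<forall>r\<in>Con P. R \<subseteq> r \<longrightarrow> p \<in> r)"
  by (auto simp: cgen_def)

text \<open>Each condition on a congruence survives intersection. Keeping \<open>R\<close> inside
  the carrier makes the full relation one of the congruences intersected; an empty family would
  intersect to the universal relation instead.\<close>

lemma cgen_in_Con:
  assumes P: "partial_prelattice P" and R: "R \<subseteq> pcarrier P \<times> pcarrier P"
  shows "cgen P R \<in> Con P"
proof (rule ConI[OF P])
  show le: "ple P \<subseteq> cgen P R"
    by (auto simp: cgen_iff dest: subsetD[OF ConD(1)])
  have "cgen P R \<subseteq> pcarrier P \<times> pcarrier P"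
    by (rule cgen_least[OF full_in_Con[OF P] R])
  moreover have "trans (cgen P R)"
  proof (rule transI)
    fix x y z assume "(x, y) \<in> cgen P R" "(y, z) \<in> cgen P R"
    then show "(x, z) \<in> cgen P R"
      unfolding cgen_iff using transD[OF ConD(5)] by metis
  qed
  ultimately show "preorder_on (pcarrier P) (cgen P R)"
    using partial_prelatticeD(2)[OF P] le by (auto simp: preorder_on_def refl_on_def)
  show "is_sup (pcarrier P) (cgen P R) X a" if X: "pjoin P X = Some a" for X a
    unfolding is_sup_def
  proof (intro conjI ballI impI)
    show "a \<in> pcarrier P" "\<And>x. x \<in> X \<Longrightarrow> (x, a) \<in> cgen P R"
      using partial_prelatticeD(5)[OF P X] le by (auto simp: is_sup_def)
    fix b assume "b \<in> pcarrier P" "\<forall>x\<in>X. (x, b) \<in> cgen P R"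
    then show "(a, b) \<in> cgen P R"
      using ConD(6)[OF _ X] unfolding cgen_iff is_sup_def by simp
  qed
  show "is_inf (pcarrier P) (cgen P R) X a" if X: "pmeet P X = Some a" for X a
    unfolding is_inf_def
  proof (intro conjI ballI impI)
    show "a \<in> pcarrier P" "\<And>x. x \<in> X \<Longrightarrow> (a, x) \<in> cgen P R"
      using partial_prelatticeD(7)[OF P X] le by (auto simp: is_inf_def)
    fix b assume "b \<in> pcarrier P" "\<forall>x\<in>X. (b, x) \<in> cgen P R"
    then show "(b, a) \<in> cgen P R"
      using ConD(7)[OF _ X] unfolding cgen_iff is_inf_def by simp
  qed
qed

lemma cgen_subset_iff:
  "r \<in> Con P \<Longrightarrow> cgen P R \<subseteq> r \<longleftrightarrow> R \<subseteq> r"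
  by (meson cgen_least order_trans subset_cgen)

lemma cgen_eq_ple:
  "partial_prelattice P \<Longrightarrow> R \<subseteq> ple P \<Longrightarrow> cgen P R = ple P"
  by (intro subset_antisym cgen_least ple_in_Con ConD(1)[OF cgen_in_Con])
    (auto dest: subsetD[OF partial_prelatticeD(1)])

lemma cgen_Un_cgen:
  assumes P: "partial_prelattice P"
    and R: "R \<subseteq> pcarrier P \<times> pcarrier P" and S: "S \<subseteq> pcarrier P \<times> pcarrier P"
  shows "cgen P (cgen P R \<union> cgen P S) = cgen P (R \<union> S)"
proof (rule subset_antisym)
  show "cgen P (cgen P R \<union> cgen P S) \<subseteq> cgen P (R \<union> S)"
    using R S by (intro cgen_least[OF cgen_in_Con[OF P]] Un_least cgen_mono Un_upper1 Un_upper2)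
  show "cgen P (R \<union> S) \<subseteq> cgen P (cgen P R \<union> cgen P S)"
    by (intro cgen_mono Un_mono subset_cgen)
qed

section \<open>Finitary generation and compact congruences\<close>

text \<open>Joins and meets are defined on finite sets only, so one closure step involves finitely
  many pairs and the finite parts of \<open>Q\<close> behind them can be merged. Hence the pairs
  obtained from finite parts of \<open>Q\<close> already form a congruence.\<close>

lemma cgen_finitary:
  assumes P: "partial_prelattice P" and Q: "Q \<subseteq> pcarrier P \<times> pcarrier P" and p: "p \<in> cgen P Q"
  shows "\<exists>R. finite R \<and> R \<subseteq> Q \<and> p \<in> cgen P R"
proof -
  define U where "U = {p. \<exists>R. finite R \<and> R \<subseteq> Q \<and> p \<in> cgen P R}"
  have cg: "cgen P R \<in> Con P" if "R \<subseteq> Q" for R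
    by (rule cgen_in_Con[OF P order_trans[OF that Q]])
  have common: "\<exists>R. finite R \<and> R \<subseteq> Q \<and> A \<subseteq> cgen P R" if "finite A" "A \<subseteq> U" for A
    using that
  proof (induction A)
    case (insert p A)
    then obtain R S where "finite R" "R \<subseteq> Q" "A \<subseteq> cgen P R"
      and "finite S" "S \<subseteq> Q" "p \<in> cgen P S"
      by (auto simp: U_def)
    then show ?case
      using cgen_mono[of R "R \<union> S" P, OF Un_upper1] cgen_mono[of S "R \<union> S" P, OF Un_upper2]
      by (intro exI[of _ "R \<union> S"]) blast
  qed auto
  have "U \<in> Con P"
  proof (rule ConI[OF P])
    show le: "ple P \<subseteq> U"
      using ConD(1)[OF cg[of "{}"]] by (auto simp: U_def)
    have tr: "trans U"
    proof (rule transI)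
      fix x y z assume "(x, y) \<in> U" "(y, z) \<in> U"
      then obtain R where "finite R" "R \<subseteq> Q" "(x, y) \<in> cgen P R" "(y, z) \<in> cgen P R"
        using common[of "{(x, y), (y, z)}"] by auto
      then show "(x, z) \<in> U"
        using transD[OF ConD(5)[OF cg[of R]]] unfolding U_def by blast
    qed
    have "U \<subseteq> pcarrier P \<times> pcarrier P"
      unfolding U_def using ConD(3)[OF cg] by blast
    then show "preorder_on (pcarrier P) U"
      using tr le partial_prelatticeD(2)[OF P] by (auto simp: preorder_on_def refl_on_def)
    show "is_sup (pcarrier P) U X a" if X: "pjoin P X = Some a" for X a
      unfolding is_sup_def
    proof (intro conjI ballI impI)
      show "a \<in> pcarrier P"
        using partial_prelatticeD(5)[OF P X] by (simp add: is_sup_def)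
      show "(x, a) \<in> U" if "x \<in> X" for x
        using partial_prelatticeD(5)[OF P X] le that unfolding is_sup_def by blast
      fix b assume b: "b \<in> pcarrier P" "\<forall>x\<in>X. (x, b) \<in> U"
      have "finite ((\<lambda>x. (x, b)) ` X)"
        using partial_prelatticeD(4)[OF P X] by (simp add: fin_subsets_def)
      then obtain R where R: "finite R" "R \<subseteq> Q" "(\<lambda>x. (x, b)) ` X \<subseteq> cgen P R"
        using common[of "(\<lambda>x. (x, b)) ` X"] b(2) by (auto simp: image_subset_iff)
      then have "(a, b) \<in> cgen P R"
        using ConD(6)[OF cg[OF R(2)] X] b unfolding is_sup_def by blast
      then show "(a, b) \<in> U" using R by (auto simp: U_def)
    qed
    show "is_inf (pcarrier P) U X a" if X: "pmeet P X = Some a" for X a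
      unfolding is_inf_def
    proof (intro conjI ballI impI)
      show "a \<in> pcarrier P"
        using partial_prelatticeD(7)[OF P X] by (simp add: is_inf_def)
      show "(a, x) \<in> U" if "x \<in> X" for x
        using partial_prelatticeD(7)[OF P X] le that unfolding is_inf_def by blast
      fix b assume b: "b \<in> pcarrier P" "\<forall>x\<in>X. (b, x) \<in> U"
      have "finite ((\<lambda>x. (b, x)) ` X)"
        using partial_prelatticeD(6)[OF P X] by (simp add: fin_subsets_def)
      then obtain R where R: "finite R" "R \<subseteq> Q" "(\<lambda>x. (b, x)) ` X \<subseteq> cgen P R"
        using common[of "(\<lambda>x. (b, x)) ` X"] b(2) by (auto simp: image_subset_iff)
      then have "(b, a) \<in> cgen P R"
        using ConD(7)[OF cg[OF R(2)] X] b unfolding is_inf_def by blast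
      then show "(b, a) \<in> U" using R by (auto simp: U_def)
    qed
  qed
  moreover have "Q \<subseteq> U"
  proof
    fix q assume "q \<in> Q"
    then show "q \<in> U"
      unfolding U_def using subset_cgen[of "{q}" P] by (intro CollectI exI[of _ "{q}"]) auto
  qed
  ultimately show ?thesis
    using cgen_least[of U P Q] p by (auto simp: U_def)
qed

text \<open>Each of the finitely many generators depends on finitely many pairs of the union of
  \<open>S\<close>, and these pairs lie in finitely many members of \<open>S\<close>.\<close>

lemma cgen_finite_in_Con_c:
  assumes P: "partial_prelattice P" and R: "R \<subseteq> pcarrier P \<times> pcarrier P" and "finite R"
  shows "cgen P R \<in> Con_c P"
proof -
  have "\<exists>F. finite F \<and> F \<subseteq> S \<and> cgen P R \<subseteq> cgen P (\<Union>F)"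
    if S: "S \<subseteq> Con P" and sub: "cgen P R \<subseteq> cgen P (\<Union>S)" for S
  proof -
    have US: "\<Union>S \<subseteq> pcarrier P \<times> pcarrier P"
      by (rule Union_least, rule ConD(3)) (rule subsetD[OF S])
    have RS: "R \<subseteq> cgen P (\<Union>S)"
      using subset_cgen sub by (rule order_trans)
    have "\<exists>Q. finite Q \<and> Q \<subseteq> \<Union>S \<and> p \<in> cgen P Q" if "p \<in> R" for p
      using cgen_finitary[OF P US subsetD[OF RS that]] .
    then obtain Q where Q: "\<And>p. p \<in> R \<Longrightarrow> finite (Q p) \<and> Q p \<subseteq> \<Union>S \<and> p \<in> cgen P (Q p)"
      by metis
    have "finite (\<Union>(Q ` R))" "\<Union>(Q ` R) \<subseteq> \<Union>S"
      using Q \<open>finite R\<close> by fast+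
    then obtain F where F: "finite F" "F \<subseteq> S" "\<Union>(Q ` R) \<subseteq> \<Union>F"
      using finite_subset_Union by metis
    have "R \<subseteq> cgen P (\<Union>F)"
    proof
      fix p assume p: "p \<in> R"
      have "Q p \<subseteq> \<Union>F" using F(3) p by blast
      then show "p \<in> cgen P (\<Union>F)"
        using Q[OF p] cgen_mono by (metis subsetD)
    qed
    moreover have "cgen P (\<Union>F) \<in> Con P"
      using F(2) US by (intro cgen_in_Con[OF P]) (metis Union_mono order_trans)
    ultimately have "cgen P R \<subseteq> cgen P (\<Union>F)"
      by (intro cgen_least)
    with F show ?thesis by metis
  qed
  then show ?thesis
    using cgen_in_Con[OF P R] by (simp add: Con_c_def)
qed

text \<open>A congruence is the join of the principal congruences of its own pairs; compactness
  keeps finitely many of them, and their pairs serve as \<open>R\<close>.\<close>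

lemma Con_cE:
  assumes P: "partial_prelattice P" and r: "r \<in> Con_c P"
  obtains R where "finite R" "R \<subseteq> pcarrier P \<times> pcarrier P" "r = cgen P R"
proof -
  have rC: "r \<in> Con P" using r by (simp add: Con_c_def)
  let ?S = "(\<lambda>p. cgen P {p}) ` r"
  have "?S \<subseteq> Con P"
    using cgen_in_Con[OF P] ConD(3)[OF rC] by auto
  moreover have "r \<subseteq> cgen P (\<Union>?S)"
  proof (rule order_trans[OF _ subset_cgen], rule subsetI)
    fix p assume "p \<in> r"
    moreover have "p \<in> cgen P {p}" using subset_cgen[of "{p}" P] by simp
    ultimately show "p \<in> \<Union>?S" by blast
  qed
  moreover have "\<forall>S. S \<subseteq> Con P \<longrightarrow> r \<subseteq> cgen P (\<Union>S) \<longrightarrow>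
      (\<exists>F. finite F \<and> F \<subseteq> S \<and> r \<subseteq> cgen P (\<Union>F))"
    using r by (simp add: Con_c_def)
  ultimately obtain F where F: "finite F" "F \<subseteq> ?S" "r \<subseteq> cgen P (\<Union>F)"
    by metis
  obtain R where R: "finite R" "R \<subseteq> r" "F = (\<lambda>p. cgen P {p}) ` R"
    using finite_subset_image[OF F(1,2)] by blast
  have RC: "R \<subseteq> pcarrier P \<times> pcarrier P" using R ConD(3)[OF rC] by blast
  have "\<Union>F \<subseteq> cgen P R"
    unfolding R(3) by (intro UN_least cgen_mono) simp
  then have "cgen P (\<Union>F) \<subseteq> cgen P R"
    by (rule cgen_least[OF cgen_in_Con[OF P RC]])
  then have "r = cgen P R"
    using F(3) cgen_least[OF rC R(2)] by blast
  then show ?thesis using that R RC by blast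
qed

lemma ple_in_Con_c: "partial_prelattice P \<Longrightarrow> ple P \<in> Con_c P"
  using cgen_finite_in_Con_c[of P "{}"] cgen_eq_ple[of P "{}"] by simp

lemma cgen_Un_in_Con_c:
  assumes P: "partial_prelattice P" and "r \<in> Con_c P" "s \<in> Con_c P"
  shows "cgen P (r \<union> s) \<in> Con_c P"
proof -
  obtain R S where "finite R" "R \<subseteq> pcarrier P \<times> pcarrier P" "r = cgen P R"
    and "finite S" "S \<subseteq> pcarrier P \<times> pcarrier P" "s = cgen P S"
    using Con_cE[OF P] assms(2,3) by metis
  then show ?thesis
    using cgen_Un_cgen[OF P] cgen_finite_in_Con_c[OF P, of "R \<union> S"] by simp
qed

section \<open>Semilattice homomorphisms evaluated on generators\<close>

lemma cgen_insert:
  assumes "partial_prelattice P" "p \<in> pcarrier P \<times> pcarrier P" "R \<subseteq> pcarrier P \<times> pcarrier P"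
  shows "cgen P (cgen P {p} \<union> cgen P R) = cgen P (insert p R)"
  using cgen_Un_cgen[OF assms(1), of "{p}" R] assms(2,3) by auto

lemma con_c_hom_insert:
  assumes P: "partial_prelattice P" and \<phi>: "con_c_hom P \<phi>"
    and "finite R" "p \<in> pcarrier P \<times> pcarrier P" "R \<subseteq> pcarrier P \<times> pcarrier P"
  shows "\<phi> (cgen P (insert p R)) = sup (\<phi> (cgen P {p})) (\<phi> (cgen P R))"
proof -
  have "cgen P {p} \<in> Con_c P" "cgen P R \<in> Con_c P"
    using cgen_finite_in_Con_c[OF P] assms(3-) by auto
  then show ?thesis
    using \<phi> cgen_insert[OF P assms(4,5)] unfolding con_c_hom_def by metis
qed

lemma con_c_hom_empty:
  "partial_prelattice P \<Longrightarrow> con_c_hom P \<phi> \<Longrightarrow> \<phi> (cgen P {}) = bot"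
  using cgen_eq_ple[of P "{}"] by (simp add: con_c_hom_def)

lemma con_c_hom_mono:
  assumes P: "partial_prelattice P" and \<phi>: "con_c_hom P \<phi>"
    and r: "r \<in> Con_c P" and s: "s \<in> Con_c P" and "r \<subseteq> s"
  shows "\<phi> r \<le> \<phi> s"
proof -
  have "cgen P (r \<union> s) = s"
    using cgen_Con[of s P] s \<open>r \<subseteq> s\<close> by (simp add: Con_c_def Un_absorb1)
  then have "\<phi> s = sup (\<phi> r) (\<phi> s)"
    using \<phi> r s unfolding con_c_hom_def by metis
  then show ?thesis by (metis sup_ge1)
qed

text \<open>Compact congruences are finite joins of principal ones, so a join homomorphism is fixed
  by its values on these. This reduces measure preservation to a check on single pairs.\<close>

lemma con_c_homs_eqI:
  assumes P: "partial_prelattice P" and "con_c_hom P \<phi>" "con_c_hom P \<psi>"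
    and eq: "\<And>a b. a \<in> pcarrier P \<Longrightarrow> b \<in> pcarrier P \<Longrightarrow>
      \<phi> (cgen P {(a, b)}) = \<psi> (cgen P {(a, b)})"
    and r: "r \<in> Con_c P"
  shows "\<phi> r = \<psi> r"
proof -
  obtain R where R: "finite R" "R \<subseteq> pcarrier P \<times> pcarrier P" and r: "r = cgen P R"
    using Con_cE[OF P r] .
  from R have "\<phi> (cgen P R) = \<psi> (cgen P R)"
  proof (induction R)
    case empty
    then show ?case using con_c_hom_empty[OF P] assms(2,3) by metis
  next
    case (insert p R)
    then have p: "p \<in> pcarrier P \<times> pcarrier P" and R: "R \<subseteq> pcarrier P \<times> pcarrier P"
      by simp_all
    have "\<phi> (cgen P {p}) = \<psi> (cgen P {p})"
      using p eq[of "fst p" "snd p"] by (simp add: mem_Times_iff)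
    with insert.IH[OF R] show ?case
      using con_c_hom_insert[OF P _ insert.hyps(1) p R] assms(2,3) by metis
  qed
  with r show ?thesis by simp
qed

section \<open>Functoriality of the congruence semilattice\<close>

text \<open>Pulling congruences back along \<open>f\<close> is adjoint to \<open>Con_c_map\<close>;
  this is what makes the image of a generated congruence computable from generators.\<close>

lemma Con_vimage:
  assumes P: "partial_prelattice P" and f: "plat_hom P Q f" and r: "r \<in> Con Q"
  shows "{(x, y) \<in> pcarrier P \<times> pcarrier P. (f x, f y) \<in> r} \<in> Con P" (is "?r \<in> _")
proof (rule ConI[OF P])
  have fC: "f x \<in> pcarrier Q" if "x \<in> pcarrier P" for x
    using f that by (auto simp: plat_hom_def)
  show "ple P \<subseteq> ?r"
    using ConD(1)[OF r] f partial_prelatticeD(1)[OF P] by (auto simp: plat_hom_def)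
  show "preorder_on (pcarrier P) ?r"
    using ConD(4)[OF r fC] ConD(5)[OF r]
    by (auto simp: preorder_on_def refl_on_def intro!: transI dest: transD)
  show "is_sup (pcarrier P) ?r X a" if X: "pjoin P X = Some a" for X a
  proof -
    have "is_sup (pcarrier Q) r (f ` X) (f a)"
      using ConD(6)[OF r] f X by (auto simp: plat_hom_def)
    moreover have "X \<subseteq> pcarrier P" "a \<in> pcarrier P"
      using partial_prelatticeD(4,5)[OF P X] by (auto simp: fin_subsets_def is_sup_def)
    ultimately show ?thesis using fC by (auto simp: is_sup_def)
  qed
  show "is_inf (pcarrier P) ?r X a" if X: "pmeet P X = Some a" for X a
  proof -
    have "is_inf (pcarrier Q) r (f ` X) (f a)"
      using ConD(7)[OF r] f X by (auto simp: plat_hom_def)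
    moreover have "X \<subseteq> pcarrier P" "a \<in> pcarrier P"
      using partial_prelatticeD(6,7)[OF P X] by (auto simp: fin_subsets_def is_inf_def)
    ultimately show ?thesis using fC by (auto simp: is_inf_def)
  qed
qed

lemma Con_c_map_alt: "Con_c_map Q f r = cgen Q (map_prod f f ` r)"
  by (auto simp: Con_c_map_def intro!: arg_cong[of _ _ "cgen Q"])

lemma map_prod_hom:
  "plat_hom P Q f \<Longrightarrow> R \<subseteq> pcarrier P \<times> pcarrier P \<Longrightarrow>
    map_prod f f ` R \<subseteq> pcarrier Q \<times> pcarrier Q"
  by (fastforce simp: plat_hom_def)

text \<open>For the nontrivial inclusion, the pullback of the right-hand side along \<open>f\<close>
  is a congruence containing \<open>R\<close>, so it contains \<open>cgen P R\<close>.\<close>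

lemma Con_c_map_cgen:
  assumes P: "partial_prelattice P" and Q: "partial_prelattice Q" and f: "plat_hom P Q f"
    and R: "R \<subseteq> pcarrier P \<times> pcarrier P"
  shows "Con_c_map Q f (cgen P R) = cgen Q (map_prod f f ` R)"
proof (rule subset_antisym)
  let ?s = "cgen Q (map_prod f f ` R)"
  have s: "?s \<in> Con Q"
    using cgen_in_Con[OF Q map_prod_hom[OF f R]] .
  have "R \<subseteq> {(x, y) \<in> pcarrier P \<times> pcarrier P. (f x, f y) \<in> ?s}"
    using R subset_cgen[of "map_prod f f ` R" Q] by force
  then have "cgen P R \<subseteq> {(x, y) \<in> pcarrier P \<times> pcarrier P. (f x, f y) \<in> ?s}"
    by (rule cgen_least[OF Con_vimage[OF P f s]])
  then show "Con_c_map Q f (cgen P R) \<subseteq> ?s"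
    unfolding Con_c_map_def by (intro cgen_least[OF s]) auto
  show "?s \<subseteq> Con_c_map Q f (cgen P R)"
    unfolding Con_c_map_alt by (intro cgen_mono image_mono subset_cgen)
qed

lemma Con_c_map_in_Con_c:
  assumes P: "partial_prelattice P" and Q: "partial_prelattice Q" and f: "plat_hom P Q f"
    and r: "r \<in> Con_c P"
  shows "Con_c_map Q f r \<in> Con_c Q"
proof -
  obtain R where R: "finite R" "R \<subseteq> pcarrier P \<times> pcarrier P" "r = cgen P R"
    using Con_cE[OF P r] .
  have "cgen Q (map_prod f f ` R) \<in> Con_c Q"
    using R(1) by (intro cgen_finite_in_Con_c[OF Q map_prod_hom[OF f R(2)]]) simp
  then show ?thesis
    using R(3) Con_c_map_cgen[OF P Q f R(2)] by simp
qed

text \<open>Serves to transport the measure of \<open>L\<close> back to a test lattice along a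
  homomorphism into \<open>L\<close>.\<close>

lemma con_c_hom_comp_map:
  assumes P: "partial_prelattice P" and Q: "partial_prelattice Q" and f: "plat_hom P Q f"
    and \<phi>: "con_c_hom Q \<phi>"
  shows "con_c_hom P (\<lambda>r. \<phi> (Con_c_map Q f r))"
  unfolding con_c_hom_def
proof (intro conjI ballI)
  have "Con_c_map Q f (ple P) = ple Q"
    unfolding Con_c_map_def using f by (intro cgen_eq_ple[OF Q]) (auto simp: plat_hom_def)
  then show "\<phi> (Con_c_map Q f (ple P)) = bot"
    using \<phi> by (simp add: con_c_hom_def)
  fix r s assume r: "r \<in> Con_c P" and s: "s \<in> Con_c P"
  obtain R where R: "finite R" "R \<subseteq> pcarrier P \<times> pcarrier P" "r = cgen P R"
    using Con_cE[OF P r] .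
  obtain S where S: "finite S" "S \<subseteq> pcarrier P \<times> pcarrier P" "s = cgen P S"
    using Con_cE[OF P s] .
  have "Con_c_map Q f (cgen P (r \<union> s)) = cgen Q (map_prod f f ` R \<union> map_prod f f ` S)"
    using Con_c_map_cgen[OF P Q f, of "R \<union> S"] cgen_Un_cgen[OF P R(2) S(2)] R S
    by (simp add: image_Un)
  also have "\<dots> = cgen Q (Con_c_map Q f r \<union> Con_c_map Q f s)"
    using cgen_Un_cgen[OF Q map_prod_hom[OF f R(2)] map_prod_hom[OF f S(2)]]
      Con_c_map_cgen[OF P Q f] R S by simp
  finally show "\<phi> (Con_c_map Q f (cgen P (r \<union> s))) =
      sup (\<phi> (Con_c_map Q f r)) (\<phi> (Con_c_map Q f s))"
    using \<phi> Con_c_map_in_Con_c[OF P Q f] r s by (simp add: con_c_hom_def)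
qed

section \<open>Measures from weights\<close>

text \<open>A measure on a finite partial lattice amounts to a weight on pairs all of whose sublevel
  sets are congruences: the weight of a pair is the measure of the congruence it generates.\<close>

definition congruence_weight ::
    "'a plat \<Rightarrow> ('a \<Rightarrow> 'a \<Rightarrow> 'd::{distrib_lattice, order_bot}) \<Rightarrow> bool" where
  "congruence_weight P w \<longleftrightarrow>
     (\<forall>d. {(x, y) \<in> pcarrier P \<times> pcarrier P. w x y \<le> d} \<in> Con P)"

text \<open>The finite join operator is meaningful on nonempty sets; inserting \<open>bot\<close>
  guarantees this and leaves the join unchanged.\<close>

definition weight_measure ::
    "('a \<Rightarrow> 'a \<Rightarrow> 'd::{distrib_lattice, order_bot}) \<Rightarrow> 'a rel \<Rightarrow> 'd" where
  "weight_measure w r = \<Squnion>\<^sub>f\<^sub>i\<^sub>n (insert bot (case_prod w ` r))"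

lemma weight_measure_le_iff:
  assumes "finite r"
  shows "weight_measure w r \<le> d \<longleftrightarrow> (\<forall>(x, y) \<in> r. w x y \<le> d)"
  using assms by (auto simp: weight_measure_def Sup_fin.bounded_iff)

text \<open>Testing the generators suffices because the sublevel set of \<open>d\<close> is a
  congruence. Knowing all upper bounds of the measure replaces computation with finite
  joins.\<close>

lemma weight_measure_cgen_le_iff:
  assumes P: "partial_prelattice P" "finite (pcarrier P)" and w: "congruence_weight P w"
    and R: "R \<subseteq> pcarrier P \<times> pcarrier P"
  shows "weight_measure w (cgen P R) \<le> d \<longleftrightarrow> (\<forall>(x, y) \<in> R. w x y \<le> d)"
proof -
  let ?r = "{(x, y) \<in> pcarrier P \<times> pcarrier P. w x y \<le> d}"
  have r: "?r \<in> Con P" using w by (simp add: congruence_weight_def)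
  have sub: "cgen P R \<subseteq> pcarrier P \<times> pcarrier P"
    using ConD(3)[OF cgen_in_Con[OF P(1) R]] .
  then have "finite (cgen P R)"
    using P(2) by (meson finite_SigmaI finite_subset)
  then have "weight_measure w (cgen P R) \<le> d \<longleftrightarrow> cgen P R \<subseteq> ?r"
    using sub by (auto simp: weight_measure_le_iff)
  also have "\<dots> \<longleftrightarrow> R \<subseteq> ?r"
    using cgen_subset_iff[OF r] .
  finally show ?thesis using R by auto
qed

lemma weight_measure_principal:
  assumes "partial_prelattice P" "finite (pcarrier P)" "congruence_weight P w"
    and "a \<in> pcarrier P" "b \<in> pcarrier P"
  shows "weight_measure w (cgen P {(a, b)}) = w a b"
  using weight_measure_cgen_le_iff[OF assms(1-3), of "{(a, b)}"] assms(4,5)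
  by (intro antisym) (auto)

lemma weight_measure_con_c_hom:
  assumes P: "partial_prelattice P" "finite (pcarrier P)" and w: "congruence_weight P w"
  shows "con_c_hom P (weight_measure w)"
  unfolding con_c_hom_def
proof (intro conjI ballI)
  have "cgen P {} = ple P"
    using cgen_eq_ple[OF P(1)] by simp
  then have "weight_measure w (ple P) \<le> bot"
    using weight_measure_cgen_le_iff[OF P w, of "{}" bot] by simp
  then show "weight_measure w (ple P) = bot"
    by (simp add: bot_unique)
  fix r s assume "r \<in> Con_c P" "s \<in> Con_c P"
  then have "r \<subseteq> pcarrier P \<times> pcarrier P" "s \<subseteq> pcarrier P \<times> pcarrier P"
    by (auto simp: Con_c_def dest: ConD(3))
  moreover from this have "finite r" "finite s"
    using P(2) by (meson finite_SigmaI finite_subset)+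
  ultimately have "weight_measure w (cgen P (r \<union> s)) \<le> d \<longleftrightarrow>
      sup (weight_measure w r) (weight_measure w s) \<le> d" for d
    using weight_measure_cgen_le_iff[OF P w, of "r \<union> s" d]
    by (auto simp: weight_measure_le_iff)
  then show "weight_measure w (cgen P (r \<union> s)) = sup (weight_measure w r) (weight_measure w s)"
    by (meson antisym order_refl)
qed

lemma weight_measure_proper:
  assumes P: "partial_prelattice P" "finite (pcarrier P)" and w: "congruence_weight P w"
    and w0: "\<And>x y. x \<in> pcarrier P \<Longrightarrow> y \<in> pcarrier P \<Longrightarrow> w x y = bot \<Longrightarrow> (x, y) \<in> ple P"
  shows "proper_measure P (weight_measure w)"
  unfolding proper_measure_def
proof (intro ballI impI)
  fix r assume r: "r \<in> Con_c P" "weight_measure w r = bot"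
  then have rC: "r \<in> Con P" by (simp add: Con_c_def)
  then have "finite r"
    using P(2) ConD(3)[OF rC] by (meson finite_SigmaI finite_subset)
  then have "\<forall>(x, y) \<in> r. w x y \<le> bot"
    using r(2) weight_measure_le_iff[of r w bot] by simp
  then have "r \<subseteq> ple P"
    using w0 ConD(3)[OF rC] by (fastforce simp: bot_unique)
  then show "r = ple P" using ConD(1)[OF rC] by simp
qed

section \<open>Extension along weighted embeddings\<close>

lemma total_latticeD:
  assumes "total_lattice L"
  shows "partial_lattice L" "partial_prelattice L" "antisym (ple L)"
  using assms by (simp_all add: total_lattice_def partial_lattice_def)

text \<open>Saturation restated with points and weights. The measure on \<open>P\<close> comes from
  \<open>w\<close>, that on \<open>K\<close> from \<open>L\<close>; by \<open>wf\<close> they agree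
  on principal congruences, so the inclusion of \<open>K\<close> in \<open>P\<close> is measure
  preserving.\<close>

lemma saturated_wrt_extend:
  assumes sat: "saturated_wrt B L \<phi>"
    and K: "finite (pcarrier K)" "total_lattice K"
    and P: "finite (pcarrier P)" "partial_lattice P"
    and e: "plat_embedding K P id" "B K P id" and f: "plat_hom K L f"
    and w: "congruence_weight P w"
    and w0: "\<And>x y. x \<in> pcarrier P \<Longrightarrow> y \<in> pcarrier P \<Longrightarrow> w x y = bot \<Longrightarrow> (x, y) \<in> ple P"
    and wf: "\<And>a b. a \<in> pcarrier K \<Longrightarrow> b \<in> pcarrier K \<Longrightarrow> w a b = \<phi> (cgen L {(f a, f b)})"
  obtains g where "plat_hom P L g" and "\<And>x. x \<in> pcarrier K \<Longrightarrow> g x = f x"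
    and "\<And>a b. a \<in> pcarrier P \<Longrightarrow> b \<in> pcarrier P \<Longrightarrow> \<phi> (cgen L {(g a, g b)}) = w a b"
proof -
  have L: "partial_prelattice L" and \<phi>: "con_c_hom L \<phi>"
    using sat by (simp_all add: saturated_wrt_def measured_plat_def partial_lattice_def)
  have K': "partial_prelattice K" using total_latticeD[OF K(2)] by simp
  have P': "partial_prelattice P" using P(2) by (simp add: partial_lattice_def)
  have eh: "plat_hom K P id" using e(1) by (simp add: plat_embedding_def)
  have KP: "x \<in> pcarrier P" if "x \<in> pcarrier K" for x
    using eh that by (auto simp: plat_hom_def)
  \<comment> \<open>With this choice \<open>f\<close> preserves measures by definition.\<close>
  define \<kappa> where "\<kappa> r = \<phi> (Con_c_map L f r)" for r
  define \<mu> where "\<mu> = weight_measure w"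
  have \<kappa>: "con_c_hom K \<kappa>"
    unfolding \<kappa>_def by (rule con_c_hom_comp_map[OF K' L f \<phi>])
  have \<kappa>_principal: "\<kappa> (cgen K {(a, b)}) = w a b" if "a \<in> pcarrier K" "b \<in> pcarrier K" for a b
    using Con_c_map_cgen[OF K' L f, of "{(a, b)}"] that wf[OF that] by (simp add: \<kappa>_def)
  have \<mu>: "con_c_hom P \<mu>"
    unfolding \<mu>_def by (rule weight_measure_con_c_hom[OF P' P(1) w])
  have \<mu>_principal: "\<mu> (cgen P {(a, b)}) = w a b" if "a \<in> pcarrier P" "b \<in> pcarrier P" for a b
    using weight_measure_principal[OF P' P(1) w that] by (simp add: \<mu>_def)
  have \<mu>_proper: "proper_measure P \<mu>"
    unfolding \<mu>_def by (rule weight_measure_proper[OF P' P(1) w w0])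
  \<comment> \<open>Properness passes from \<open>w\<close> to \<kappa>: a pair of weight
    \<open>bot\<close> is ordered in \<open>P\<close>, and the embedding reflects the order.\<close>
  have \<kappa>_proper: "proper_measure K \<kappa>"
    unfolding proper_measure_def
  proof (intro ballI impI)
    fix r assume r: "r \<in> Con_c K" "\<kappa> r = bot"
    then have rC: "r \<in> Con K" by (simp add: Con_c_def)
    have "(a, b) \<in> ple K" if ab: "(a, b) \<in> r" for a b
    proof -
      have abK: "a \<in> pcarrier K" "b \<in> pcarrier K" using ConD(3)[OF rC] ab by auto
      have "cgen K {(a, b)} \<in> Con_c K"
        using cgen_finite_in_Con_c[OF K', of "{(a, b)}"] abK by simp
      moreover have "cgen K {(a, b)} \<subseteq> r"
        using cgen_least[OF rC] ab by simp
      ultimately have "w a b \<le> bot"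
        using con_c_hom_mono[OF K' \<kappa> _ r(1)] r(2) \<kappa>_principal[OF abK] by metis
      then have "(a, b) \<in> ple P"
        using w0 KP abK by (simp add: bot_unique)
      then show ?thesis using e(1) abK by (simp add: plat_embedding_def)
    qed
    then show "r = ple K" using ConD(1)[OF rC] by auto
  qed
  have pres: "measure_preserving K \<kappa> P \<mu> id"
    unfolding measure_preserving_def
  proof
    fix r assume r: "r \<in> Con_c K"
    show "\<mu> (Con_c_map P id r) = \<kappa> r"
    proof (rule con_c_homs_eqI[OF K' con_c_hom_comp_map[OF K' P' eh \<mu>] \<kappa> _ r])
      fix a b assume ab: "a \<in> pcarrier K" "b \<in> pcarrier K"
      then show "\<mu> (Con_c_map P id (cgen K {(a, b)})) = \<kappa> (cgen K {(a, b)})"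
        using Con_c_map_cgen[OF K' P' eh, of "{(a, b)}"] \<kappa>_principal \<mu>_principal KP by simp
    qed
  qed
  have "measured_embedding K \<kappa> P \<mu> id"
    using e(1) pres by (simp add: measured_embedding_def)
  moreover have "measured_hom K \<kappa> L \<phi> f"
    using f by (simp add: measured_hom_def measure_preserving_def \<kappa>_def)
  moreover have "measured_plat K \<kappa>" "measured_plat P \<mu>"
    using total_latticeD[OF K(2)] P(2) \<kappa> \<mu> by (simp_all add: measured_plat_def)
  ultimately obtain g where g: "measured_hom P \<mu> L \<phi> g" "\<forall>x\<in>pcarrier K. g (id x) = f x"
    using sat K P(1) \<kappa>_proper \<mu>_proper e(2) unfolding saturated_wrt_def by blast
  have gh: "plat_hom P L g" using g(1) by (simp add: measured_hom_def)
  have "\<phi> (cgen L {(g a, g b)}) = w a b" if ab: "a \<in> pcarrier P" "b \<in> pcarrier P" for a b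
  proof -
    have "cgen P {(a, b)} \<in> Con_c P"
      using cgen_finite_in_Con_c[OF P', of "{(a, b)}"] ab by simp
    then have "\<phi> (Con_c_map L g (cgen P {(a, b)})) = w a b"
      using g(1) \<mu>_principal[OF ab] by (simp add: measured_hom_def measure_preserving_def)
    then show ?thesis
      using Con_c_map_cgen[OF P' L gh, of "{(a, b)}"] ab by simp
  qed
  then show ?thesis using that[OF gh] g(2) by simp
qed

section \<open>Lattices of height at most two\<close>

lemma is_inf_converse: "is_inf A r X a \<longleftrightarrow> is_sup A (r\<inverse>) X a"
  by (simp add: is_sup_def is_inf_def)

lemma is_sup_unique:
  "antisym r \<Longrightarrow> is_sup A r X a \<Longrightarrow> is_sup A r X b \<Longrightarrow> a = b"
  by (auto simp: is_sup_def dest: antisymD)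

lemma is_inf_unique:
  "antisym r \<Longrightarrow> is_inf A r X a \<Longrightarrow> is_inf A r X b \<Longrightarrow> a = b"
  by (auto simp: is_inf_def dest: antisymD)

lemma total_lattice_pjoin_iff:
  assumes "total_lattice L"
  shows "pjoin L X = Some a \<longleftrightarrow> X \<in> fin_subsets (pcarrier L) \<and> is_sup (pcarrier L) (ple L) X a"
proof -
  note L = total_latticeD[OF assms]
  show ?thesis
    using assms partial_prelatticeD(4,5)[OF L(2)] is_sup_unique[OF L(3)]
    unfolding total_lattice_def by (metis not_None_eq)
qed

lemma total_lattice_pmeet_iff:
  assumes "total_lattice L"
  shows "pmeet L X = Some a \<longleftrightarrow> X \<in> fin_subsets (pcarrier L) \<and> is_inf (pcarrier L) (ple L) X a"
proof -
  note L = total_latticeD[OF assms]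
  show ?thesis
    using assms partial_prelatticeD(6,7)[OF L(2)] is_inf_unique[OF L(3)]
    unfolding total_lattice_def by (metis not_None_eq)
qed

section \<open>Partial lattices from partial orders\<close>

text \<open>The largest choice of partial operations: every supremum or infimum of a nonempty finite
  set that exists is recorded. The choice operator picks a unique element as soon as
  \<open>r\<close> is antisymmetric.\<close>

definition poset_plat :: "'a set \<Rightarrow> 'a rel \<Rightarrow> 'a plat" where
  "poset_plat A r = \<lparr>pcarrier = A, ple = r,
     pjoin = \<lambda>X. if X \<in> fin_subsets A \<and> (\<exists>a. is_sup A r X a) then Some (SOME a. is_sup A r X a) else None,
     pmeet = \<lambda>X. if X \<in> fin_subsets A \<and> (\<exists>a. is_inf A r X a) then Some (SOME a. is_inf A r X a) else None\<rparr>"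

lemma poset_plat_simps [simp]:
  "pcarrier (poset_plat A r) = A" "ple (poset_plat A r) = r"
  by (simp_all add: poset_plat_def)

lemma poset_plat_pjoin_iff:
  assumes "antisym r"
  shows "pjoin (poset_plat A r) X = Some a \<longleftrightarrow> X \<in> fin_subsets A \<and> is_sup A r X a"
  using is_sup_unique[OF assms] by (auto simp: poset_plat_def intro: someI some_equality)

lemma poset_plat_pmeet_iff:
  assumes "antisym r"
  shows "pmeet (poset_plat A r) X = Some a \<longleftrightarrow> X \<in> fin_subsets A \<and> is_inf A r X a"
  using is_inf_unique[OF assms] by (auto simp: poset_plat_def intro: someI some_equality)

lemma partial_lattice_poset_plat:
  assumes "A \<noteq> {}" "partial_order_on A r"
  shows "partial_lattice (poset_plat A r)"
  using assms
  by (simp add: partial_lattice_def partial_prelattice_def partial_order_on_def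
      poset_plat_pjoin_iff poset_plat_pmeet_iff)

lemma is_sup_pair:
  "preorder_on A r \<Longrightarrow> (x, y) \<in> r \<Longrightarrow> is_sup A r {x, y} y"
  by (auto simp: is_sup_def preorder_on_def refl_on_def)

text \<open>Suprema are built one element at a time, and a monotone map respects the supremum of a
  comparable pair, so only incomparable pairs carry a condition. With \<open>f\<close> the identity
  this yields existence of suprema, and also the supremum condition for a congruence
  \<open>s\<close>, which is why \<open>s\<close> is just a preorder.\<close>

lemma is_sup_image:
  assumes r: "preorder_on A r" "antisym r" and s: "preorder_on B s"
    and f: "\<And>x y. (x, y) \<in> r \<Longrightarrow> (f x, f y) \<in> s"
    and bin: "\<And>x y. x \<in> A \<Longrightarrow> y \<in> A \<Longrightarrow> (x, y) \<notin> r \<Longrightarrow> (y, x) \<notin> r \<Longrightarrow>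
      \<exists>a. is_sup A r {x, y} a \<and> is_sup B s {f x, f y} (f a)"
    and X: "finite X" "X \<noteq> {}" "X \<subseteq> A"
  shows "\<exists>a. is_sup A r X a \<and> is_sup B s (f ` X) (f a)"
  using X
proof (induction X rule: finite_ne_induct)
  case (singleton x)
  then show ?case
    using is_sup_pair[OF r(1), of x x] is_sup_pair[OF s, of "f x" "f x"] f[of x x] r(1)
    by (auto simp: preorder_on_def refl_on_def)
next
  case (insert x X)
  then obtain b where b: "is_sup A r X b" "is_sup B s (f ` X) (f b)"
    by auto
  have xb: "x \<in> A" "b \<in> A" using insert b by (auto simp: is_sup_def)
  have "\<exists>a. is_sup A r {x, b} a \<and> is_sup B s {f x, f b} (f a)"
  proof (cases "(x, b) \<in> r \<or> (b, x) \<in> r")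
    case True
    then show ?thesis
      using is_sup_pair[OF r(1)] is_sup_pair[OF s] f by (metis insert_commute)
  next
    case False
    then show ?thesis using bin xb by simp
  qed
  then obtain a where a: "is_sup A r {x, b} a" "is_sup B s {f x, f b} (f a)"
    by auto
  \<comment> \<open>Associativity of suprema, polymorphic because it is applied both in
    \<open>A\<close> and in \<open>B\<close>.\<close>
  have join: "is_sup C t (insert u Y) d"
    if "trans t" "is_sup C t Y c" "is_sup C t {u, c} d" for C :: "'z set" and t Y c u d
    using that unfolding is_sup_def by (auto dest: transD)
  have "trans r" "trans s" using r(1) s by (simp_all add: preorder_on_def)
  then show ?case
    using join a b by (metis image_insert)
qed

lemma is_inf_image:
  assumes r: "preorder_on A r" "antisym r" and s: "preorder_on B s"
    and f: "\<And>x y. (x, y) \<in> r \<Longrightarrow> (f x, f y) \<in> s"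
    and bin: "\<And>x y. x \<in> A \<Longrightarrow> y \<in> A \<Longrightarrow> (x, y) \<notin> r \<Longrightarrow> (y, x) \<notin> r \<Longrightarrow>
      \<exists>a. is_inf A r {x, y} a \<and> is_inf B s {f x, f y} (f a)"
    and X: "finite X" "X \<noteq> {}" "X \<subseteq> A"
  shows "\<exists>a. is_inf A r X a \<and> is_inf B s (f ` X) (f a)"
  using is_sup_image[of A "r\<inverse>" B "s\<inverse>" f X] r s f bin X
  by (simp add: is_inf_converse)

text \<open>The chains with at most three elements, the square and \<open>M\<^sub>3\<close> all have this form, and the
  inclusions between them are the test embeddings to which saturation is applied.\<close>

definition fan_le :: "nat set \<Rightarrow> nat rel" where
  "fan_le A = {(x, y) \<in> A \<times> A. x = y \<or> x = 0 \<or> y = 1}"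

abbreviation fan :: "nat set \<Rightarrow> nat plat" where
  "fan A \<equiv> poset_plat A (fan_le A)"

text \<open>In a fan \<open>0\<close> is the bottom, \<open>1\<close> the top, and all other
  elements are pairwise incomparable. The second alternative is the one-point lattice, from which
  the tests for lower and upper saturation start.\<close>

definition fan_total :: "nat set \<Rightarrow> bool" where
  "fan_total A \<longleftrightarrow> {0, 1} \<subseteq> A \<or> (\<exists>k. A = {k})"

lemma partial_order_fan_le: "partial_order_on A (fan_le A)"
  by (auto simp: partial_order_on_def preorder_on_def refl_on_def fan_le_def
      intro!: transI antisymI)

lemma fan_leD: "preorder_on A (fan_le A)" "antisym (fan_le A)"
  using partial_order_fan_le[of A] by (simp_all add: partial_order_on_def)

text \<open>Incomparable elements of a fan are distinct atoms, and their supremum is the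
  top.\<close>

lemma fan_sup:
  assumes A: "fan_total A" and s: "preorder_on B s"
    and f: "\<And>x y. (x, y) \<in> fan_le A \<Longrightarrow> (f x, f y) \<in> s"
    and atoms: "\<And>x y. x \<in> A - {0, 1} \<Longrightarrow> y \<in> A - {0, 1} \<Longrightarrow> x \<noteq> y \<Longrightarrow>
      is_sup B s {f x, f y} (f 1)"
    and X: "X \<in> fin_subsets A"
  shows "\<exists>a. is_sup A (fan_le A) X a \<and> is_sup B s (f ` X) (f a)"
proof (rule is_sup_image[OF fan_leD s f])
  fix x y assume xy: "x \<in> A" "y \<in> A" "(x, y) \<notin> fan_le A" "(y, x) \<notin> fan_le A"
  then have at: "x \<in> A - {0, 1}" "y \<in> A - {0, 1}" "x \<noteq> y"
    by (auto simp: fan_le_def)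
  then have "1 \<in> A" using A by (auto simp: fan_total_def)
  then have "is_sup A (fan_le A) {x, y} 1"
    using at by (auto simp: is_sup_def fan_le_def)
  then show "\<exists>a. is_sup A (fan_le A) {x, y} a \<and> is_sup B s {f x, f y} (f a)"
    using atoms[OF at] by blast
qed (use X in \<open>simp_all add: fin_subsets_def\<close>)

lemma fan_inf:
  assumes A: "fan_total A" and s: "preorder_on B s"
    and f: "\<And>x y. (x, y) \<in> fan_le A \<Longrightarrow> (f x, f y) \<in> s"
    and atoms: "\<And>x y. x \<in> A - {0, 1} \<Longrightarrow> y \<in> A - {0, 1} \<Longrightarrow> x \<noteq> y \<Longrightarrow>
      is_inf B s {f x, f y} (f 0)"
    and X: "X \<in> fin_subsets A"
  shows "\<exists>a. is_inf A (fan_le A) X a \<and> is_inf B s (f ` X) (f a)"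
proof (rule is_inf_image[OF fan_leD s f])
  fix x y assume xy: "x \<in> A" "y \<in> A" "(x, y) \<notin> fan_le A" "(y, x) \<notin> fan_le A"
  then have at: "x \<in> A - {0, 1}" "y \<in> A - {0, 1}" "x \<noteq> y"
    by (auto simp: fan_le_def)
  then have "0 \<in> A" using A by (auto simp: fan_total_def)
  then have "is_inf A (fan_le A) {x, y} 0"
    using at by (auto simp: is_inf_def fan_le_def)
  then show "\<exists>a. is_inf A (fan_le A) {x, y} a \<and> is_inf B s {f x, f y} (f a)"
    using atoms[OF at] by blast
qed (use X in \<open>simp_all add: fin_subsets_def\<close>)

lemma fan_pjoin_iff:
  "pjoin (fan A) X = Some a \<longleftrightarrow> X \<in> fin_subsets A \<and> is_sup A (fan_le A) X a"
  by (rule poset_plat_pjoin_iff[OF fan_leD(2)])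

lemma fan_pmeet_iff:
  "pmeet (fan A) X = Some a \<longleftrightarrow> X \<in> fin_subsets A \<and> is_inf A (fan_le A) X a"
  by (rule poset_plat_pmeet_iff[OF fan_leD(2)])

lemma partial_lattice_fan: "A \<noteq> {} \<Longrightarrow> partial_lattice (fan A)"
  by (rule partial_lattice_poset_plat[OF _ partial_order_fan_le])

lemma fan_atoms_sup:
  "1 \<in> A \<Longrightarrow> x \<in> A - {0, 1} \<Longrightarrow> y \<in> A - {0, 1} \<Longrightarrow> x \<noteq> y \<Longrightarrow> is_sup A (fan_le A) {x, y} 1"
  by (auto simp: is_sup_def fan_le_def)

lemma fan_atoms_inf:
  "0 \<in> A \<Longrightarrow> x \<in> A - {0, 1} \<Longrightarrow> y \<in> A - {0, 1} \<Longrightarrow> x \<noteq> y \<Longrightarrow> is_inf A (fan_le A) {x, y} 0"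
  by (auto simp: is_inf_def fan_le_def)

text \<open>The two equivalences for \<open>Q\<close> hold for total lattices as well as for fans,
  so one lemma provides both the maps into \<open>L\<close> and the inclusions between fans.\<close>

lemma fan_hom:
  assumes A: "fan_total A"
    and Q: "preorder_on (pcarrier Q) (ple Q)"
      "\<And>X a. pjoin Q X = Some a \<longleftrightarrow> X \<in> fin_subsets (pcarrier Q) \<and> is_sup (pcarrier Q) (ple Q) X a"
      "\<And>X a. pmeet Q X = Some a \<longleftrightarrow> X \<in> fin_subsets (pcarrier Q) \<and> is_inf (pcarrier Q) (ple Q) X a"
    and f: "\<And>x y. (x, y) \<in> fan_le A \<Longrightarrow> (f x, f y) \<in> ple Q"
    and atoms: "\<And>x y. x \<in> A - {0, 1} \<Longrightarrow> y \<in> A - {0, 1} \<Longrightarrow> x \<noteq> y \<Longrightarrow>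
      is_sup (pcarrier Q) (ple Q) {f x, f y} (f 1) \<and> is_inf (pcarrier Q) (ple Q) {f x, f y} (f 0)"
  shows "plat_hom (fan A) Q f"
proof -
  have fA: "f x \<in> pcarrier Q" if "x \<in> A" for x
    using f[of x x] that Q(1) by (auto simp: fan_le_def preorder_on_def)
  then have fX: "f ` X \<in> fin_subsets (pcarrier Q)" if "X \<in> fin_subsets A" for X
    using that by (auto simp: fin_subsets_def)
  have "is_sup (pcarrier Q) (ple Q) (f ` X) (f a)"
    if "X \<in> fin_subsets A" "is_sup A (fan_le A) X a" for X a
  proof -
    have "\<exists>a. is_sup A (fan_le A) X a \<and> is_sup (pcarrier Q) (ple Q) (f ` X) (f a)"
      by (rule fan_sup[OF A Q(1) f _ that(1)]) (use atoms in auto)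
    then show ?thesis
      using is_sup_unique[OF fan_leD(2) that(2)] by auto
  qed
  moreover have "is_inf (pcarrier Q) (ple Q) (f ` X) (f a)"
    if "X \<in> fin_subsets A" "is_inf A (fan_le A) X a" for X a
  proof -
    have "\<exists>a. is_inf A (fan_le A) X a \<and> is_inf (pcarrier Q) (ple Q) (f ` X) (f a)"
      by (rule fan_inf[OF A Q(1) f _ that(1)]) (use atoms in auto)
    then show ?thesis
      using is_inf_unique[OF fan_leD(2) that(2)] by auto
  qed
  ultimately show ?thesis
    unfolding plat_hom_def fan_pjoin_iff fan_pmeet_iff Q(2,3) using fA fX f by simp blast
qed

lemma total_lattice_fan:
  assumes A: "fan_total A"
  shows "total_lattice (fan A)"
  unfolding total_lattice_def
proof (intro conjI ballI)
  show "partial_lattice (fan A)"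
    using A by (intro partial_lattice_fan) (auto simp: fan_total_def)
  fix X assume X: "X \<in> fin_subsets (pcarrier (fan A))"
  have at: "is_sup A (fan_le A) {x, y} 1" "is_inf A (fan_le A) {x, y} 0"
    if "x \<in> A - {0, 1}" "y \<in> A - {0, 1}" "x \<noteq> y" for x y
    using A that fan_atoms_sup[OF _ that] fan_atoms_inf[OF _ that] by (auto simp: fan_total_def)
  have "\<exists>a. is_sup A (fan_le A) X a \<and> is_sup A (fan_le A) (id ` X) (id a)"
    by (rule fan_sup[OF A fan_leD(1)]) (use X at in auto)
  moreover have "\<exists>a. is_inf A (fan_le A) X a \<and> is_inf A (fan_le A) (id ` X) (id a)"
    by (rule fan_inf[OF A fan_leD(1)]) (use X at in auto)
  ultimately show "pjoin (fan A) X \<noteq> None" "pmeet (fan A) X \<noteq> None"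
    using X by (auto simp: poset_plat_def)
qed

lemma fan_embedding:
  assumes A: "fan_total A" and "A \<subseteq> A'"
  shows "plat_embedding (fan A) (fan A') id"
proof -
  have "plat_hom (fan A) (fan A') id"
  proof (rule fan_hom[OF A])
    show "(id x, id y) \<in> ple (fan A')" if "(x, y) \<in> fan_le A" for x y
      using that \<open>A \<subseteq> A'\<close> by (auto simp: fan_le_def)
    fix x y assume xy: "x \<in> A - {0, 1}" "y \<in> A - {0, 1}" "x \<noteq> y"
    then have "0 \<in> A'" "1 \<in> A'" using A \<open>A \<subseteq> A'\<close> by (auto simp: fan_total_def)
    then show "is_sup (pcarrier (fan A')) (ple (fan A')) {id x, id y} (id 1) \<and>
        is_inf (pcarrier (fan A')) (ple (fan A')) {id x, id y} (id 0)"
      using xy \<open>A \<subseteq> A'\<close> fan_atoms_sup[of A' x y] fan_atoms_inf[of A' x y] by auto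
  qed (simp_all add: fan_pjoin_iff fan_pmeet_iff fan_leD)
  then show ?thesis by (auto simp: plat_embedding_def fan_le_def)
qed

text \<open>A congruence is a coarser preorder for which the identity still preserves suprema and
  infima. Thus \<open>fan_sup\<close> and \<open>fan_inf\<close> apply with \<open>id\<close> and
  leave only pairs of atoms to check.\<close>

lemma fan_ConI:
  assumes A: "fan_total A" and r: "fan_le A \<subseteq> r" "preorder_on A r"
    and atoms: "\<And>x y. x \<in> A - {0, 1} \<Longrightarrow> y \<in> A - {0, 1} \<Longrightarrow> x \<noteq> y \<Longrightarrow>
      is_sup A r {x, y} 1 \<and> is_inf A r {x, y} 0"
  shows "r \<in> Con (fan A)"
proof (rule ConI)
  show "partial_prelattice (fan A)"
    using total_latticeD(2)[OF total_lattice_fan[OF A]] .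
  show "is_sup (pcarrier (fan A)) r X a" if "pjoin (fan A) X = Some a" for X a
  proof -
    have X: "X \<in> fin_subsets A" "is_sup A (fan_le A) X a"
      using that by (simp_all add: fan_pjoin_iff)
    have "\<exists>a. is_sup A (fan_le A) X a \<and> is_sup A r (id ` X) (id a)"
      by (rule fan_sup[OF A r(2) _ _ X(1)]) (use r(1) atoms in auto)
    then show ?thesis
      using is_sup_unique[OF fan_leD(2) X(2)] by auto
  qed
  show "is_inf (pcarrier (fan A)) r X a" if "pmeet (fan A) X = Some a" for X a
  proof -
    have X: "X \<in> fin_subsets A" "is_inf A (fan_le A) X a"
      using that by (simp_all add: fan_pmeet_iff)
    have "\<exists>a. is_inf A (fan_le A) X a \<and> is_inf A r (id ` X) (id a)"
      by (rule fan_inf[OF A r(2) _ _ X(1)]) (use r(1) atoms in auto)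
    then show ?thesis
      using is_inf_unique[OF fan_leD(2) X(2)] by auto
  qed
qed (use r in simp_all)

text \<open>The numbers \<open>0, 1, 2, 3\<close> stand for the subsets \<open>{}\<close>, \<open>{\<alpha>, \<beta>}\<close>, \<open>{\<alpha>}\<close>,
  \<open>{\<beta>}\<close>, and the weight of \<open>(x, y)\<close> is the join of the elements of \<open>x\<close> outside \<open>y\<close>.\<close>

definition square_weight :: "'d \<Rightarrow> 'd \<Rightarrow> nat \<Rightarrow> nat \<Rightarrow> 'd::{distrib_lattice, order_bot}" where
  "square_weight \<alpha> \<beta> x y =
     sup (if x \<in> {1, 2} \<and> y \<notin> {1, 2} then \<alpha> else bot) (if x \<in> {1, 3} \<and> y \<notin> {1, 3} then \<beta> else bot)"

lemma square_weight_le_iff: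
  "square_weight \<alpha> \<beta> x y \<le> d \<longleftrightarrow>
    (x \<in> {1, 2} \<and> y \<notin> {1, 2} \<longrightarrow> \<alpha> \<le> d) \<and> (x \<in> {1, 3} \<and> y \<notin> {1, 3} \<longrightarrow> \<beta> \<le> d)"
proof -
  have "(if P then c else bot) \<le> d \<longleftrightarrow> (P \<longrightarrow> c \<le> d)" for P c
    by simp
  then show ?thesis
    unfolding square_weight_def le_sup_iff by (intro arg_cong2[of _ _ _ _ "(\<and>)"])
qed

text \<open>The sublevel set of \<open>d\<close> compares two subsets only in those coordinates
  whose value is not below \<open>d\<close>, so it is the kernel of a projection. Allowing
  \<open>A\<close> to vary covers the three-element chain together with the square.\<close>

lemma square_weight_congruence:
  assumes A: "{0, 1} \<subseteq> A" "A \<subseteq> {0, 1, 2, 3}"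
  shows "congruence_weight (fan A) (square_weight \<alpha> \<beta>)"
  unfolding congruence_weight_def
proof
  fix d
  have t: "fan_total A" using A by (simp add: fan_total_def)
  let ?r = "{(x, y) \<in> A \<times> A. (x \<in> {1, 2} \<and> y \<notin> {1, 2} \<longrightarrow> \<alpha> \<le> d) \<and> (x \<in> {1, 3} \<and> y \<notin> {1, 3} \<longrightarrow> \<beta> \<le> d)}"
  have "?r \<in> Con (fan A)"
  proof (rule fan_ConI[OF t])
    show "fan_le A \<subseteq> ?r" by (auto simp: fan_le_def)
    show "preorder_on A ?r"
      by (auto simp: preorder_on_def refl_on_def intro!: transI)
    fix x y assume "x \<in> A - {0, 1}" "y \<in> A - {0, 1}" "x \<noteq> y"
    then have "{x, y} = {2, 3}" "2 \<in> A" "3 \<in> A" using A by auto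
    moreover have "0 \<in> A" "1 \<in> A" using A by auto
    ultimately show "is_sup A ?r {x, y} 1 \<and> is_inf A ?r {x, y} 0"
      by (simp add: is_sup_def is_inf_def)
  qed
  also have "?r = {(x, y) \<in> pcarrier (fan A) \<times> pcarrier (fan A). square_weight \<alpha> \<beta> x y \<le> d}"
    unfolding square_weight_le_iff by simp
  finally show "{(x, y) \<in> pcarrier (fan A) \<times> pcarrier (fan A). square_weight \<alpha> \<beta> x y \<le> d} \<in> Con (fan A)" .
qed

lemma square_weight_proper:
  fixes \<alpha> \<beta> :: "'d::{distrib_lattice, order_bot}"
  assumes A: "A \<subseteq> {0, 1, 2, 3}" and ab: "\<alpha> \<noteq> bot" "\<beta> \<noteq> bot" and xy: "x \<in> A" "y \<in> A"
    and w: "square_weight \<alpha> \<beta> x y = bot"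
  shows "(x, y) \<in> fan_le A"
proof -
  have "(if x \<in> {1, 2} \<and> y \<notin> {1, 2} then \<alpha> else bot) \<le> bot"
    and "(if x \<in> {1, 3} \<and> y \<notin> {1, 3} then \<beta> else bot) \<le> bot"
    using w unfolding square_weight_def by (metis sup_ge1, metis sup_ge2)
  then have "x \<in> {1, 2} \<longrightarrow> y \<in> {1, 2}" "x \<in> {1, 3} \<longrightarrow> y \<in> {1, 3}"
    using ab by (auto simp: bot_unique split: if_splits)
  moreover have "x \<in> {0, 1, 2, 3}" "y \<in> {0, 1, 2, 3}"
    using A xy by blast+
  ultimately show ?thesis
    using xy by (auto simp: fan_le_def)
qed

text \<open>The weight suited to a simple lattice: its only possible sublevel sets are the order and
  the full relation. It is applied to the two-element chain and to \<open>M\<^sub>3\<close>.\<close>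

definition simple_weight :: "'a rel \<Rightarrow> 'd \<Rightarrow> 'a \<Rightarrow> 'a \<Rightarrow> 'd::{distrib_lattice, order_bot}" where
  "simple_weight r d x y = (if (x, y) \<in> r then bot else d)"

lemma simple_weight_congruence:
  assumes "partial_prelattice P"
  shows "congruence_weight P (simple_weight (ple P) d)"
  unfolding congruence_weight_def
proof
  fix c
  have "{(x, y) \<in> pcarrier P \<times> pcarrier P. simple_weight (ple P) d x y \<le> c} =
      (if d \<le> c then pcarrier P \<times> pcarrier P else ple P)"
    using partial_prelatticeD(1)[OF assms] by (auto simp: simple_weight_def split: if_splits)
  then show "{(x, y) \<in> pcarrier P \<times> pcarrier P. simple_weight (ple P) d x y \<le> c} \<in> Con P"
    using full_in_Con[OF assms] ple_in_Con[OF assms] by simp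
qed

lemma fan_bot:
  assumes "0 \<in> A"
  shows "lbot (fan A) = 0"
  using assms by (auto simp: lbot_def fan_le_def intro!: the_equality)

lemma fan_top:
  assumes "1 \<in> A"
  shows "ltop (fan A) = 1"
  using assms by (auto simp: ltop_def fan_le_def intro!: the_equality)

lemma fan_lower_map: "0 \<in> A \<Longrightarrow> A \<subseteq> A' \<Longrightarrow> lower_map (fan A) (fan A') id"
  unfolding lower_map_def fan_bot by (auto simp: fan_le_def)

lemma fan_upper_map: "1 \<in> A \<Longrightarrow> A \<subseteq> A' \<Longrightarrow> upper_map (fan A) (fan A') id"
  unfolding upper_map_def fan_top by (auto simp: fan_le_def)

lemma fan_internal_map: "{0, 1} \<subseteq> A \<Longrightarrow> A \<subseteq> A' \<Longrightarrow> internal_map (fan A) (fan A') id"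
  by (simp add: internal_map_def fan_lower_map fan_upper_map)

section \<open>Congruences of a lattice\<close>

locale total_lat =
  fixes L :: "'a plat"
  assumes total: "total_lattice L"
begin

abbreviation C :: "'a set" where "C \<equiv> pcarrier L"
abbreviation le :: "'a \<Rightarrow> 'a \<Rightarrow> bool" (infix "\<sqsubseteq>" 50) where "x \<sqsubseteq> y \<equiv> (x, y) \<in> ple L"
abbreviation join :: "'a \<Rightarrow> 'a \<Rightarrow> 'a" (infixl "\<squnion>" 65) where "x \<squnion> y \<equiv> lsup L x y"
abbreviation meet :: "'a \<Rightarrow> 'a \<Rightarrow> 'a" (infixl "\<sqinter>" 70) where "x \<sqinter> y \<equiv> linf L x y"
abbreviation cg :: "'a \<Rightarrow> 'a \<Rightarrow> 'a rel" where "cg x y \<equiv> cgen L {(x, y)}"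

lemma prelattice: "partial_prelattice L"
  using total_latticeD[OF total] by simp

lemma le_carrier: "x \<sqsubseteq> y \<Longrightarrow> x \<in> C" "x \<sqsubseteq> y \<Longrightarrow> y \<in> C"
  using partial_prelatticeD(1)[OF prelattice] by auto

lemma le_refl: "x \<in> C \<Longrightarrow> x \<sqsubseteq> x"
  by (rule partial_prelatticeD(2)[OF prelattice])

lemma le_trans: "x \<sqsubseteq> y \<Longrightarrow> y \<sqsubseteq> z \<Longrightarrow> x \<sqsubseteq> z"
  by (rule transD[OF partial_prelatticeD(3)[OF prelattice]])

lemma le_antisym: "x \<sqsubseteq> y \<Longrightarrow> y \<sqsubseteq> x \<Longrightarrow> x = y"
  by (rule antisymD[OF total_latticeD(3)[OF total]])

lemma is_sup_join:
  assumes "x \<in> C" "y \<in> C"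
  shows "is_sup C (ple L) {x, y} (x \<squnion> y)"
proof -
  have X: "{x, y} \<in> fin_subsets C" using assms by (simp add: fin_subsets_def)
  then have "pjoin L {x, y} = Some (x \<squnion> y)"
    using total by (auto simp: total_lattice_def lsup_def)
  then show ?thesis using total_lattice_pjoin_iff[OF total] by simp
qed

lemma is_inf_meet:
  assumes "x \<in> C" "y \<in> C"
  shows "is_inf C (ple L) {x, y} (x \<sqinter> y)"
proof -
  have X: "{x, y} \<in> fin_subsets C" using assms by (simp add: fin_subsets_def)
  then have "pmeet L {x, y} = Some (x \<sqinter> y)"
    using total by (auto simp: total_lattice_def linf_def)
  then show ?thesis using total_lattice_pmeet_iff[OF total] by simp
qed

lemma pjoin_pair: "x \<in> C \<Longrightarrow> y \<in> C \<Longrightarrow> pjoin L {x, y} = Some (x \<squnion> y)"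
  using is_sup_join total_lattice_pjoin_iff[OF total] by (simp add: fin_subsets_def)

lemma pmeet_pair: "x \<in> C \<Longrightarrow> y \<in> C \<Longrightarrow> pmeet L {x, y} = Some (x \<sqinter> y)"
  using is_inf_meet total_lattice_pmeet_iff[OF total] by (simp add: fin_subsets_def)

lemma join_closed: "x \<in> C \<Longrightarrow> y \<in> C \<Longrightarrow> x \<squnion> y \<in> C"
  using is_sup_join by (simp add: is_sup_def)

lemma meet_closed: "x \<in> C \<Longrightarrow> y \<in> C \<Longrightarrow> x \<sqinter> y \<in> C"
  using is_inf_meet by (simp add: is_inf_def)

lemma join_ge1: "x \<in> C \<Longrightarrow> y \<in> C \<Longrightarrow> x \<sqsubseteq> x \<squnion> y"
  using is_sup_join by (simp add: is_sup_def)

lemma join_ge2: "x \<in> C \<Longrightarrow> y \<in> C \<Longrightarrow> y \<sqsubseteq> x \<squnion> y"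
  using is_sup_join by (simp add: is_sup_def)

lemma join_least: "x \<sqsubseteq> z \<Longrightarrow> y \<sqsubseteq> z \<Longrightarrow> x \<squnion> y \<sqsubseteq> z"
  using is_sup_join[of x y] le_carrier by (auto simp: is_sup_def)

lemma meet_le1: "x \<in> C \<Longrightarrow> y \<in> C \<Longrightarrow> x \<sqinter> y \<sqsubseteq> x"
  using is_inf_meet by (simp add: is_inf_def)

lemma meet_le2: "x \<in> C \<Longrightarrow> y \<in> C \<Longrightarrow> x \<sqinter> y \<sqsubseteq> y"
  using is_inf_meet by (simp add: is_inf_def)

lemma meet_greatest: "z \<sqsubseteq> x \<Longrightarrow> z \<sqsubseteq> y \<Longrightarrow> z \<sqsubseteq> x \<sqinter> y"
  using is_inf_meet[of x y] le_carrier by (auto simp: is_inf_def)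

lemma join_comm: "x \<squnion> y = y \<squnion> x"
  by (simp add: lsup_def insert_commute)

lemma meet_comm: "x \<sqinter> y = y \<sqinter> x"
  by (simp add: linf_def insert_commute)

lemma join_absorb: "x \<sqsubseteq> y \<Longrightarrow> x \<squnion> y = y"
  by (meson join_ge2 join_least le_antisym le_carrier le_refl)

lemma meet_absorb: "x \<sqsubseteq> y \<Longrightarrow> x \<sqinter> y = x"
  by (meson meet_greatest meet_le1 le_antisym le_carrier le_refl)

lemma Con_trans: "r \<in> Con L \<Longrightarrow> (x, y) \<in> r \<Longrightarrow> (y, z) \<in> r \<Longrightarrow> (x, z) \<in> r"
  using transD[OF ConD(5)] .

lemma Con_le: "r \<in> Con L \<Longrightarrow> x \<sqsubseteq> y \<Longrightarrow> (x, y) \<in> r"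
  using subsetD[OF ConD(1)] .

lemma Con_join:
  assumes "r \<in> Con L" "(x, z) \<in> r" "(y, z) \<in> r"
  shows "(x \<squnion> y, z) \<in> r"
proof -
  have "x \<in> C" "y \<in> C" "z \<in> C" using ConD(3)[OF assms(1)] assms(2,3) by auto
  then show ?thesis
    using ConD(6)[OF assms(1) pjoin_pair] assms(2,3) by (simp add: is_sup_def)
qed

lemma Con_meet:
  assumes "r \<in> Con L" "(z, x) \<in> r" "(z, y) \<in> r"
  shows "(z, x \<sqinter> y) \<in> r"
proof -
  have "x \<in> C" "y \<in> C" "z \<in> C" using ConD(3)[OF assms(1)] assms(2,3) by auto
  then show ?thesis
    using ConD(7)[OF assms(1) pmeet_pair] assms(2,3) by (simp add: is_inf_def)
qed

lemma cg_eqI: "(\<And>r. r \<in> Con L \<Longrightarrow> (a, b) \<in> r \<longleftrightarrow> (c, d) \<in> r) \<Longrightarrow> cg a b = cg c d"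
  unfolding cgen_def by (rule arg_cong[of _ _ "\<lambda>X. \<Inter>X"]) auto

lemma cg_in_Con: "x \<in> C \<Longrightarrow> y \<in> C \<Longrightarrow> cg x y \<in> Con L"
  using cgen_in_Con[OF prelattice] by simp

lemma cg_in_Con_c: "x \<in> C \<Longrightarrow> y \<in> C \<Longrightarrow> cg x y \<in> Con_c L"
  using cgen_finite_in_Con_c[OF prelattice] by simp

lemma mem_cg: "(x, y) \<in> cg x y"
  using subset_cgen[of "{(x, y)}" L] by simp

lemma cg_least: "r \<in> Con L \<Longrightarrow> (x, y) \<in> r \<Longrightarrow> cg x y \<subseteq> r"
  by (rule cgen_least) auto

text \<open>Congruences contain the order, so one of the two pairs generating \<open>Theta\<close>
  comes for free.\<close>

lemma Theta_cg: "u \<sqsubseteq> a \<Longrightarrow> Theta L u a = cg a u"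
  unfolding Theta_def cgen_def
  by (rule arg_cong[of _ _ "\<lambda>X. \<Inter>X"]) (auto dest: Con_le)

lemma Con_join_left: "r \<in> Con L \<Longrightarrow> x \<in> C \<Longrightarrow> y \<in> C \<Longrightarrow> (x \<squnion> y, y) \<in> r \<longleftrightarrow> (x, y) \<in> r"
  using Con_join[of r x y y] Con_trans[of r x "x \<squnion> y" y] Con_le join_ge1 ConD(4) by metis

lemma cg_join: "x \<in> C \<Longrightarrow> y \<in> C \<Longrightarrow> cg (x \<squnion> y) y = cg x y"
  by (rule cg_eqI) (rule Con_join_left)

lemma cg_meet:
  assumes "x \<in> C" "y \<in> C"
  shows "cg x (x \<sqinter> y) = cg x y"
proof (rule cg_eqI)
  fix r assume r: "r \<in> Con L"
  show "(x, x \<sqinter> y) \<in> r \<longleftrightarrow> (x, y) \<in> r"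
    using Con_meet[OF r, of x x y] Con_trans[OF r, of x "x \<sqinter> y" y]
      Con_le[OF r meet_le2[OF assms]] ConD(4)[OF r assms(1)] by metis
qed

text \<open>Transposed intervals: both sides equal \<open>cg x y\<close>.\<close>

lemma cg_quadrilateral: "x \<in> C \<Longrightarrow> y \<in> C \<Longrightarrow> cg (x \<squnion> y) y = cg x (x \<sqinter> y)"
  by (simp add: cg_join cg_meet)

lemma cg_chain:
  assumes "x \<sqsubseteq> y" "y \<sqsubseteq> z" "r \<in> Con L"
  shows "(z, x) \<in> r \<longleftrightarrow> (z, y) \<in> r \<and> (y, x) \<in> r"
  using Con_trans[OF assms(3)] Con_le[OF assms(3) assms(1)] Con_le[OF assms(3) assms(2)] by blast

text \<open>In the preorder \<open>r\<close>, \<open>a\<close> lies below \<open>u\<close> and so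
  below \<open>z\<close>; hence \<open>z \<squnion> a\<close>, and with it \<open>b\<close>, falls
  below \<open>z\<close>. Then \<open>b\<close> falls below \<open>z \<sqinter> b\<close>, which is
  \<open>z \<sqinter> a\<close>, and thus below \<open>a\<close> and \<open>u\<close>.\<close>

lemma perspective_Con:
  assumes r: "r \<in> Con L" and uz: "u \<sqsubseteq> z" and C: "a \<in> C" "b \<in> C"
    and z: "z \<sqinter> a = z \<sqinter> b" "z \<squnion> a = z \<squnion> b" and a: "(a, u) \<in> r"
  shows "(b, u) \<in> r"
proof -
  have zC: "z \<in> C" using uz le_carrier by blast
  have "(a, z) \<in> r" using Con_trans[OF r a Con_le[OF r uz]] .
  then have "(z \<squnion> a, z) \<in> r"
    using Con_join[OF r ConD(4)[OF r zC]] by simp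
  then have "(b, z) \<in> r"
    using Con_trans[OF r Con_le[OF r join_ge2[OF zC C(2)]]] z(2) by simp
  then have "(b, z \<sqinter> b) \<in> r"
    using Con_meet[OF r _ ConD(4)[OF r C(2)]] by simp
  then have "(b, a) \<in> r"
    using Con_trans[OF r _ Con_le[OF r meet_le2[OF zC C(1)]]] z(1) by simp
  then show ?thesis using Con_trans[OF r _ a] by simp
qed

lemma perspective_cg:
  assumes "u \<sqsubseteq> z" "a \<in> C" "b \<in> C" "z \<sqinter> a = z \<sqinter> b" "z \<squnion> a = z \<squnion> b"
  shows "cg a u = cg b u"
proof (rule cg_eqI)
  fix r assume r: "r \<in> Con L"
  show "(a, u) \<in> r \<longleftrightarrow> (b, u) \<in> r"
    using perspective_Con[OF r assms] perspective_Con[OF r assms(1,3,2) assms(4,5)[symmetric]]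
    by (rule iffI)
qed

end

section \<open>Saturated lattices\<close>

lemma sup_bot_eq:
  fixes a :: "'d::{distrib_lattice, order_bot}"
  shows "sup a bot = a" "sup bot a = a"
  by (simp_all add: sup_absorb1 sup_absorb2)

locale proper_measured_lat = total_lat L for L :: "'a plat" +
  fixes \<phi> :: "'a rel \<Rightarrow> 'd::{distrib_lattice, order_bot}"
  assumes hom: "con_c_hom L \<phi>" and proper: "proper_measure L \<phi>"
begin

definition v :: "'a \<Rightarrow> 'a \<Rightarrow> 'd" where "v x y = \<phi> (cg x y)"

lemma v_le: "r \<in> Con_c L \<Longrightarrow> (x, y) \<in> r \<Longrightarrow> v x y \<le> \<phi> r"
proof -
  assume r: "r \<in> Con_c L" "(x, y) \<in> r"
  then have rC: "r \<in> Con L" by (simp add: Con_c_def)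
  then have "x \<in> C" "y \<in> C" using ConD(3) r(2) by auto
  then show "v x y \<le> \<phi> r"
    unfolding v_def
    by (intro con_c_hom_mono[OF prelattice hom cg_in_Con_c r(1)] cg_least[OF rC r(2)])
qed

text \<open>This is where properness enters: a principal congruence of measure \<open>bot\<close> is
  the order itself.\<close>

lemma v_eq_bot_iff:
  assumes "x \<in> C" "y \<in> C"
  shows "v x y = bot \<longleftrightarrow> x \<sqsubseteq> y"
proof
  assume "v x y = bot"
  then have "cg x y = ple L"
    using proper cg_in_Con_c[OF assms] by (simp add: proper_measure_def v_def)
  then show "x \<sqsubseteq> y" using mem_cg[of x y] by simp
next
  assume "x \<sqsubseteq> y"
  then have "cg x y = ple L" by (intro cgen_eq_ple[OF prelattice]) simp
  then show "v x y = bot" using hom by (simp add: v_def con_c_hom_def)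
qed

text \<open>A congruence collapses an interval exactly when it collapses both parts, and \<phi>
  turns the join of their principal congruences into a supremum.\<close>

lemma v_chain:
  assumes "x \<sqsubseteq> y" "y \<sqsubseteq> z"
  shows "v z x = sup (v z y) (v y x)"
proof -
  have xyz: "x \<in> C" "y \<in> C" "z \<in> C" using assms le_carrier by auto
  have "cgen L {(z, y), (y, x)} = cg z x"
    unfolding cgen_def
    by (rule arg_cong[of _ _ "\<lambda>X. \<Inter>X"]) (use cg_chain[OF assms] in auto)
  then show ?thesis
    using con_c_hom_insert[OF prelattice hom, of "{(y, x)}" "(z, y)"] xyz by (simp add: v_def)
qed

lemma v_chain_le:
  assumes "x \<sqsubseteq> y" "y \<sqsubseteq> z"
  shows "v y x \<le> v z x" "v z y \<le> v z x"
  using v_chain[OF assms] by simp_all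

text \<open>Replaces an arbitrary pair by an interval, to which splitting applies.\<close>

lemma v_join: "x \<in> C \<Longrightarrow> y \<in> C \<Longrightarrow> v (x \<squnion> y) y = v x y"
  by (simp add: v_def cg_join)

lemma v_meet: "x \<in> C \<Longrightarrow> y \<in> C \<Longrightarrow> v x (x \<sqinter> y) = v x y"
  by (simp add: v_def cg_meet)

text \<open>\<open>saturated_wrt_extend\<close> for inclusions of fans. The side conditions in
  \<open>wf\<close> single out the pairs outside the fan order; on the others both sides are
  \<open>bot\<close>.\<close>

lemma fan_extend:
  assumes sat: "saturated_wrt B L \<phi>"
    and A: "fan_total A" "A \<subseteq> A'" "finite A'" and B: "B (fan A) (fan A') id"
    and f: "\<And>x y. (x, y) \<in> fan_le A \<Longrightarrow> f x \<sqsubseteq> f y"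
    and atoms: "\<And>x y. x \<in> A - {0, 1} \<Longrightarrow> y \<in> A - {0, 1} \<Longrightarrow> x \<noteq> y \<Longrightarrow>
      f x \<squnion> f y = f 1 \<and> f x \<sqinter> f y = f 0"
    and w: "congruence_weight (fan A') w"
      "\<And>x y. x \<in> A' \<Longrightarrow> y \<in> A' \<Longrightarrow> w x y = bot \<Longrightarrow> (x, y) \<in> fan_le A'"
    and wf: "\<And>x y. x \<in> A \<Longrightarrow> y \<in> A \<Longrightarrow> x \<noteq> 0 \<Longrightarrow> y \<noteq> 1 \<Longrightarrow> x \<noteq> y \<Longrightarrow> w x y = v (f x) (f y)"
  obtains g where "\<And>x. x \<in> A \<Longrightarrow> g x = f x" "\<And>x y. (x, y) \<in> fan_le A' \<Longrightarrow> g x \<sqsubseteq> g y"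
    "\<And>x y. x \<in> A' \<Longrightarrow> y \<in> A' \<Longrightarrow> v (g x) (g y) = w x y"
    "\<And>x y. x \<in> A' - {0, 1} \<Longrightarrow> y \<in> A' - {0, 1} \<Longrightarrow> x \<noteq> y \<Longrightarrow> {0, 1} \<subseteq> A' \<Longrightarrow>
      g x \<squnion> g y = g 1 \<and> g x \<sqinter> g y = g 0"
proof -
  have fC: "f x \<in> C" if "x \<in> A" for x
    using f[of x x] le_carrier that by (simp add: fan_le_def)
  have ne: "A' \<noteq> {}" using A by (auto simp: fan_total_def)
  have fh: "plat_hom (fan A) L f"
  proof (rule fan_hom[OF A(1)])
    show "preorder_on C (ple L)"
      using prelattice by (simp add: partial_prelattice_def)
    fix x y assume xy: "x \<in> A - {0, 1}" "y \<in> A - {0, 1}" "x \<noteq> y"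
    then show "is_sup C (ple L) {f x, f y} (f 1) \<and> is_inf C (ple L) {f x, f y} (f 0)"
      using is_sup_join[OF fC fC] is_inf_meet[OF fC fC] atoms[OF xy] by fastforce
  qed (use f total_lattice_pjoin_iff[OF total] total_lattice_pmeet_iff[OF total] in auto)
  have wv: "w x y = \<phi> (cg (f x) (f y))" if xy: "x \<in> pcarrier (fan A)" "y \<in> pcarrier (fan A)" for x y
  proof (cases "(x, y) \<in> fan_le A")
    case True
    then have "(x, y) \<in> fan_le A'" using A(2) by (auto simp: fan_le_def)
    \<comment> \<open>The sublevel set at \<open>bot\<close> is a congruence and therefore contains
      the order.\<close>
    then have "w x y \<le> bot"
      using w(1) ConD(1)[of _ "fan A'"] by (fastforce simp: congruence_weight_def)
    moreover have "v (f x) (f y) = bot"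
      using v_eq_bot_iff fC f[OF True] xy by simp
    ultimately show ?thesis by (simp add: v_def bot_unique)
  next
    case False
    then show ?thesis using wf xy by (simp add: fan_le_def v_def)
  qed
  obtain g where g: "plat_hom (fan A') L g" "\<And>x. x \<in> pcarrier (fan A) \<Longrightarrow> g x = f x"
      "\<And>a b. a \<in> pcarrier (fan A') \<Longrightarrow> b \<in> pcarrier (fan A') \<Longrightarrow> \<phi> (cg (g a) (g b)) = w a b"
    by (rule saturated_wrt_extend[OF sat _ total_lattice_fan[OF A(1)] _ partial_lattice_fan[OF ne]
          fan_embedding[OF A(1,2)] B fh w(1) _ wv])
      (use A(2,3) w(2) finite_subset in auto)
  have "g x \<squnion> g y = g 1 \<and> g x \<sqinter> g y = g 0"
    if xy: "x \<in> A' - {0, 1}" "y \<in> A' - {0, 1}" "x \<noteq> y" "{0, 1} \<subseteq> A'" for x y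
  proof -
    have "pjoin (fan A') {x, y} = Some 1" "pmeet (fan A') {x, y} = Some 0"
      using fan_atoms_sup[OF _ xy(1-3)] fan_atoms_inf[OF _ xy(1-3)] xy
      by (auto simp: fan_pjoin_iff fan_pmeet_iff fin_subsets_def)
    then have "pjoin L (g ` {x, y}) = Some (g 1)" "pmeet L (g ` {x, y}) = Some (g 0)"
      using g(1) unfolding plat_hom_def by blast+
    then show ?thesis by (simp add: lsup_def linf_def)
  qed
  moreover have "g x \<sqsubseteq> g y" if "(x, y) \<in> fan_le A'" for x y
    using g(1) that by (simp add: plat_hom_def)
  ultimately show ?thesis
    using that[of g] g(2,3) by (simp add: v_def)
qed

text \<open>Test embedding: the point in the two-element chain.\<close>

lemma attains_value:
  assumes sat: "saturated_wrt B L \<phi>" and A: "A = {0} \<or> A = {1}" and B: "B (fan A) (fan {0, 1}) id"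
    and d: "d \<noteq> bot"
  shows "\<exists>x\<in>C. \<exists>y\<in>C. v x y = d"
proof -
  obtain c where c: "c \<in> C"
    using prelattice by (auto simp: partial_prelattice_def)
  have P: "partial_prelattice (fan {0, 1})"
    using partial_lattice_fan[of "{0, 1}"] by (simp add: partial_lattice_def)
  have w0: "(x, y) \<in> fan_le {0, 1}"
    if "x \<in> {0, 1}" "y \<in> {0, 1}" "simple_weight (ple (fan {0, 1})) d x y = bot" for x y
    using that d by (simp add: simple_weight_def split: if_splits)
  \<comment> \<open>The single point goes to an arbitrary \<open>c\<close>; the end added to the
    chain realises \<open>d\<close>.\<close>
  obtain g :: "nat \<Rightarrow> 'a" where g: "\<And>x y. (x, y) \<in> fan_le {0, 1} \<Longrightarrow> g x \<sqsubseteq> g y"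
      "\<And>x y. x \<in> {0, 1} \<Longrightarrow> y \<in> {0, 1} \<Longrightarrow> v (g x) (g y) = simple_weight (ple (fan {0, 1})) d x y"
    by (rule fan_extend[OF sat _ _ _ B _ _ simple_weight_congruence[OF P] w0, of "\<lambda>_. c"])
      (use A c le_refl in \<open>auto simp: fan_total_def\<close>)
  have "v (g 1) (g 0) = d" using g(2)[of 1 0] by (simp add: simple_weight_def fan_le_def)
  moreover have "g 1 \<in> C" "g 0 \<in> C"
    using g(1)[of 0 1] le_carrier by (auto simp: fan_le_def)
  ultimately show ?thesis by blast
qed

end

section \<open>Splitting, complements and common complements\<close>

locale internally_saturated_lat = proper_measured_lat +
  assumes sat: "saturated_wrt internal_map L \<phi>"
begin

text \<open>Test embedding: the two-element chain in the three-element chain.\<close>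

lemma split_interval:
  assumes ab: "a \<sqsubseteq> b" and v: "v b a = sup \<alpha> \<beta>"
  shows "\<exists>x. a \<sqsubseteq> x \<and> x \<sqsubseteq> b \<and> v x a = \<alpha> \<and> v b x = \<beta>"
proof -
  have C: "a \<in> C" "b \<in> C" using ab le_carrier by auto
  \<comment> \<open>The weight on the chain is proper only for nonzero \<alpha> and \<beta>;
    otherwise an endpoint serves as \<open>x\<close>.\<close>
  consider "\<alpha> = bot" | "\<beta> = bot" | "\<alpha> \<noteq> bot" "\<beta> \<noteq> bot" by blast
  then show ?thesis
  proof cases
    case 1
    then show ?thesis
      using v C ab le_refl v_eq_bot_iff by (intro exI[of _ a]) (auto simp: sup_bot_eq)
  next
    case 2
    then show ?thesis
      using v C ab le_refl v_eq_bot_iff by (intro exI[of _ b]) (auto simp: sup_bot_eq)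
  next
    case 3
    obtain g where g: "\<And>x. x \<in> {0, 1} \<Longrightarrow> g x = (\<lambda>n::nat. if n = 0 then a else b) x"
      "\<And>x y. (x, y) \<in> fan_le {0, 1, 2} \<Longrightarrow> g x \<sqsubseteq> g y"
      "\<And>x y. x \<in> {0, 1, 2} \<Longrightarrow> y \<in> {0, 1, 2} \<Longrightarrow> v (g x) (g y) = square_weight \<alpha> \<beta> x y"
    \<comment> \<open>The chain is \<open>{}\<close>, \<open>{\<alpha>}\<close>,
      \<open>{\<alpha>, \<beta>}\<close>; its middle element \<open>2\<close> is sent to the
      splitting point.\<close>
    proof (rule fan_extend[OF sat, of "{0, 1}" "{0, 1, 2}" "\<lambda>n. if n = 0 then a else b" "square_weight \<alpha> \<beta>"])
      show "internal_map (fan {0, 1}) (fan {0, 1, 2}) id"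
        by (rule fan_internal_map) auto
      show "congruence_weight (fan {0, 1, 2}) (square_weight \<alpha> \<beta>)"
        by (rule square_weight_congruence) auto
      show "(x, y) \<in> fan_le {0, 1, 2}"
        if "x \<in> {0, 1, 2}" "y \<in> {0, 1, 2}" "square_weight \<alpha> \<beta> x y = bot" for x y
        using square_weight_proper[OF _ 3 that] by simp
    qed (use ab C le_refl v in \<open>auto simp: fan_total_def fan_le_def square_weight_def\<close>)
    then show ?thesis
      using g(1)[of 0] g(1)[of 1] g(2)[of 0 2] g(2)[of 2 1] g(3)[of 2 0] g(3)[of 1 2]
      by (intro exI[of _ "g 2"]) (simp add: fan_le_def square_weight_def sup_bot_eq)
  qed
qed

text \<open>Test embedding: the three-element chain in the square.\<close>

lemma complement:
  assumes ux: "u \<sqsubseteq> x" and xi: "x \<sqsubseteq> i"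
  shows "\<exists>y. u \<sqsubseteq> y \<and> y \<sqsubseteq> i \<and> x \<sqinter> y = u \<and> x \<squnion> y = i"
proof -
  have C: "u \<in> C" "x \<in> C" "i \<in> C" and ui: "u \<sqsubseteq> i"
    using ux xi le_carrier le_trans by blast+
  consider "x \<sqsubseteq> u" | "i \<sqsubseteq> x" | "v x u \<noteq> bot" "v i x \<noteq> bot"
    using v_eq_bot_iff C by blast
  then show ?thesis
  proof cases
    case 1
    then have "x = u" using ux le_antisym by blast
    then show ?thesis
      using ui C le_refl meet_absorb join_absorb by (intro exI[of _ i]) simp
  next
    case 2
    then have "x = i" using xi le_antisym by blast
    then show ?thesis
      using ui C le_refl meet_absorb join_absorb meet_comm join_comm by (intro exI[of _ u]) metis
  next
    case 3
    let ?f = "\<lambda>n::nat. if n = 0 then u else if n = 1 then i else x"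
    obtain g where g: "\<And>x. x \<in> {0, 1, 2} \<Longrightarrow> g x = ?f x"
      "\<And>x y. (x, y) \<in> fan_le {0, 1, 2, 3} \<Longrightarrow> g x \<sqsubseteq> g y"
      "\<And>x y. x \<in> {0, 1, 2, 3} - {0, 1} \<Longrightarrow> y \<in> {0, 1, 2, 3} - {0, 1} \<Longrightarrow> x \<noteq> y \<Longrightarrow>
        {0, 1} \<subseteq> {0, 1, 2, 3::nat} \<Longrightarrow> g x \<squnion> g y = g 1 \<and> g x \<sqinter> g y = g 0"
    \<comment> \<open>These two values make the square weight agree with the measure on the chain
      from \<open>u\<close> through \<open>x\<close> to \<open>i\<close>; the second atom
      \<open>3\<close> becomes the complement.\<close>
    proof (rule fan_extend[OF sat, of "{0, 1, 2}" "{0, 1, 2, 3}" ?f "square_weight (v x u) (v i x)"])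
      show "internal_map (fan {0, 1, 2}) (fan {0, 1, 2, 3}) id"
        by (rule fan_internal_map) auto
      show "congruence_weight (fan {0, 1, 2, 3}) (square_weight (v x u) (v i x))"
        by (rule square_weight_congruence) auto
      show "(a, b) \<in> fan_le {0, 1, 2, 3}"
        if "a \<in> {0, 1, 2, 3}" "b \<in> {0, 1, 2, 3}" "square_weight (v x u) (v i x) a b = bot" for a b
        using square_weight_proper[OF _ 3 that] by simp
      show "square_weight (v x u) (v i x) a b = v (?f a) (?f b)"
        if "a \<in> {0, 1, 2}" "b \<in> {0, 1, 2}" "a \<noteq> 0" "b \<noteq> 1" "a \<noteq> b" for a b
        using that v_chain[OF ux xi]
        by (auto simp: square_weight_def sup_bot_eq sup_commute)
    qed (use ux xi ui C le_refl in \<open>auto simp: fan_total_def fan_le_def\<close>)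
    then show ?thesis
      using g(1)[of 0] g(1)[of 1] g(1)[of 2] g(2)[of 0 3] g(2)[of 3 1] g(3)[of 2 3]
      by (intro exI[of _ "g 3"]) (simp add: fan_le_def)
  qed
qed

text \<open>Test embedding: the square in \<open>M\<^sub>3\<close>.\<close>

lemma common_complement:
  assumes xy: "x \<in> C" "y \<in> C" and v: "v x (x \<sqinter> y) = v y (x \<sqinter> y)"
  shows "\<exists>z. x \<sqinter> y \<sqsubseteq> z \<and> z \<sqsubseteq> x \<squnion> y \<and> z \<sqinter> x = x \<sqinter> y \<and> z \<sqinter> y = x \<sqinter> y \<and>
    z \<squnion> x = x \<squnion> y \<and> z \<squnion> y = x \<squnion> y"
proof -
  let ?o = "x \<sqinter> y" and ?i = "x \<squnion> y" and ?d = "v x (x \<sqinter> y)"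
  have C: "?o \<in> C" "?i \<in> C" using xy meet_closed join_closed by auto
  have le: "?o \<sqsubseteq> x" "?o \<sqsubseteq> y" "x \<sqsubseteq> ?i" "y \<sqsubseteq> ?i"
    using xy meet_le1 meet_le2 join_ge1 join_ge2 by auto
  have oi: "?o \<sqsubseteq> ?i" using le le_trans by blast
  show ?thesis
  proof (cases "?d = bot")
    case True
    then have "v x ?o = bot" "v y ?o = bot" using v by simp_all
    then have "x \<sqsubseteq> ?o" "y \<sqsubseteq> ?o" using v_eq_bot_iff C xy by simp_all
    then have "x = ?o" "y = ?o" using le le_antisym by blast+
    then have "x = y" by metis
    then show ?thesis
      using xy le_refl meet_absorb join_absorb by (intro exI[of _ x]) simp
  next
    case False
    \<comment> \<open>Every unordered step of the square spanned by \<open>x\<close> and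
      \<open>y\<close> has the same measure, as a simple weight on \<open>M\<^sub>3\<close>
      demands.\<close>
    have vxy: "v x y = ?d" using v_meet[OF xy] by simp
    have vyx: "v y x = ?d" using v_meet[OF xy(2,1)] v meet_comm by metis
    have viy: "v ?i y = ?d" using v_join[OF xy] vxy by simp
    have vix: "v ?i x = ?d" using v_join[OF xy(2,1)] vyx join_comm by metis
    have vio: "v ?i ?o = ?d" using v_chain[OF le(1,3)] vix by simp
    let ?A = "{0, 1, 2, 3} :: nat set" and ?A' = "{0, 1, 2, 3, 4} :: nat set"
    define f where "f n = (if n = 0 then ?o else if n = 1 then ?i else if n = 2 then x else y)" for n :: nat
    have f: "f 0 = ?o" "f 1 = ?i" "f 2 = x" "f 3 = y" by (simp_all add: f_def)
    have f_bounds: "?o \<sqsubseteq> f n" "f n \<sqsubseteq> ?i" "f n \<sqsubseteq> f n" for n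
      using le oi C xy le_refl by (simp_all add: f_def)
    let ?w = "simple_weight (ple (fan ?A')) ?d"
    have P: "partial_prelattice (fan ?A')"
      using partial_lattice_fan[of ?A'] by (simp add: partial_lattice_def)
    obtain g where g: "\<And>x. x \<in> ?A \<Longrightarrow> g x = f x"
      "\<And>x y. (x, y) \<in> fan_le ?A' \<Longrightarrow> g x \<sqsubseteq> g y"
      "\<And>x y. x \<in> ?A' - {0, 1} \<Longrightarrow> y \<in> ?A' - {0, 1} \<Longrightarrow> x \<noteq> y \<Longrightarrow>
        {0, 1} \<subseteq> ?A' \<Longrightarrow> g x \<squnion> g y = g 1 \<and> g x \<sqinter> g y = g 0"
    proof (rule fan_extend[OF sat, of ?A ?A' f ?w])
      show "internal_map (fan ?A) (fan ?A') id"
        by (rule fan_internal_map) auto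
      show "congruence_weight (fan ?A') ?w"
        by (rule simple_weight_congruence[OF P])
      show "(a, b) \<in> fan_le ?A'" if "?w a b = bot" for a b
        using that False by (simp add: simple_weight_def split: if_splits)
      show "?w a b = v (f a) (f b)"
        if "a \<in> ?A" "b \<in> ?A" "a \<noteq> 0" "b \<noteq> 1" "a \<noteq> b" for a b
      proof -
        have "v (f a) (f b) = ?d"
          using that vxy vyx vix viy vio v by (elim insertE emptyE) (simp_all add: f_def)
        then show ?thesis using that by (simp add: simple_weight_def fan_le_def)
      qed
      show "f a \<sqsubseteq> f b" if "(a, b) \<in> fan_le ?A" for a b
      proof -
        have "a = b \<or> a = 0 \<or> b = 1" using that by (auto simp: fan_le_def)
        then show ?thesis using f_bounds f(1,2) by metis
      qed
      show "f a \<squnion> f b = f 1 \<and> f a \<sqinter> f b = f 0"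
        if "a \<in> ?A - {0, 1}" "b \<in> ?A - {0, 1}" "a \<noteq> b" for a b
        using that by (auto simp: f_def join_comm meet_comm)
    qed (auto simp: fan_total_def)
    then show ?thesis
      using g(1)[of 0] g(1)[of 1] g(1)[of 2] g(1)[of 3] g(2)[of 0 4] g(2)[of 4 1]
        g(3)[of 4 2] g(3)[of 4 3]
      by (intro exI[of _ "g 4"]) (simp add: fan_le_def f_def)
  qed
qed

section \<open>The measure reflects inclusion\<close>

text \<open>A complement \<open>s\<close> of \<open>b\<close> in the interval from \<open>u\<close>
  to \<open>a \<squnion> b\<close> makes the interval from \<open>u\<close> to \<open>s\<close> a
  transpose of the one from \<open>b\<close> to \<open>a \<squnion> b\<close>.\<close>

lemma transpose_to_bottom:
  assumes C: "a \<in> C" and ub: "u \<sqsubseteq> b"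
  shows "\<exists>s. u \<sqsubseteq> s \<and> cg a b = cg s u"
proof -
  have bC: "b \<in> C" using ub le_carrier by blast
  obtain s where s: "u \<sqsubseteq> s" "s \<sqsubseteq> a \<squnion> b" "b \<sqinter> s = u" "b \<squnion> s = a \<squnion> b"
    using complement[OF ub join_ge2[OF C bC]] by blast
  have "cg a b = cg (s \<squnion> b) b" using cg_join[OF C bC] s(4) join_comm by metis
  also have "\<dots> = cg s (s \<sqinter> b)"
    using s(1) le_carrier bC by (intro cg_quadrilateral) auto
  also have "s \<sqinter> b = u" using s(3) meet_comm by metis
  finally show ?thesis using s(1) by blast
qed

lemma cg_reflect_common_bottom:
  assumes ux: "u \<sqsubseteq> x" and uy: "u \<sqsubseteq> y" and v: "v x u \<le> v y u"
  shows "(x, u) \<in> cg y u"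
proof -
  have C: "u \<in> C" "x \<in> C" "y \<in> C" using ux uy le_carrier by auto
  let ?c = "x \<sqinter> y"
  have uc: "u \<sqsubseteq> ?c" and cx: "?c \<sqsubseteq> x" and cy: "?c \<sqsubseteq> y"
    using meet_greatest[OF ux uy] meet_le1 meet_le2 C by auto
  obtain x' where x': "u \<sqsubseteq> x'" "x' \<sqsubseteq> x" "?c \<sqinter> x' = u" "?c \<squnion> x' = x"
    using complement[OF uc cx] by blast
  have "v x' u \<le> v y u" using v_chain_le(1)[OF x'(1,2)] v by (rule order_trans)
  \<comment> \<open>Absorption exhibits \<open>v y u\<close> as a join with first term
    \<open>v x' u\<close>, so splitting yields \<open>y'\<close>.\<close>
  then have "v y u = sup (v x' u) (v y u)" by (simp add: sup_absorb2)
  then obtain y' where y': "u \<sqsubseteq> y'" "y' \<sqsubseteq> y" "v y' u = v x' u"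
    using split_interval[OF uy] by metis
  have C': "x' \<in> C" "y' \<in> C" using x' y' le_carrier by auto
  \<comment> \<open>Below \<open>x'\<close> and \<open>y'\<close> means below \<open>x\<close>,
    \<open>y\<close> and \<open>x'\<close>, hence below \<open>u\<close>; over this meet a common
    complement exists.\<close>
  have "x' \<sqinter> y' \<sqsubseteq> ?c \<sqinter> x'"
    using meet_le1[OF C'] meet_le2[OF C'] x'(2) y'(2) by (intro meet_greatest) (blast intro: le_trans)+
  then have x'y': "x' \<sqinter> y' = u"
    using x' y' meet_greatest le_antisym by metis
  obtain z where z: "u \<sqsubseteq> z" "z \<sqinter> x' = u" "z \<sqinter> y' = u" "z \<squnion> x' = z \<squnion> y'"
    using common_complement[OF C'] x'y' y'(3) by metis
  have eq: "cg x' u = cg y' u"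
    using perspective_cg[OF z(1) C'] z by simp
  have r: "cg y u \<in> Con L" using cg_in_Con C by simp
  \<comment> \<open>As \<open>x\<close> is the join of \<open>?c\<close> and \<open>x'\<close>, it
    suffices to collapse both to \<open>u\<close>.\<close>
  have "(y', u) \<in> cg y u" "(?c, u) \<in> cg y u"
    using Con_trans[OF r Con_le[OF r y'(2)] mem_cg] Con_trans[OF r Con_le[OF r cy] mem_cg] by auto
  moreover from this have "(x', u) \<in> cg y u"
    using cg_least[OF r] eq mem_cg by blast
  ultimately show ?thesis using Con_join[OF r] x'(4) by metis
qed

text \<open>Both pairs are transposed to intervals over the common bottom
  \<open>b \<sqinter> q\<close>.\<close>

lemma cg_reflect:
  assumes C: "a \<in> C" "b \<in> C" "p \<in> C" "q \<in> C" and v: "v a b \<le> v p q"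
  shows "(a, b) \<in> cg p q"
proof -
  obtain s where s: "b \<sqinter> q \<sqsubseteq> s" "cg a b = cg s (b \<sqinter> q)"
    using transpose_to_bottom[OF C(1) meet_le1[OF C(2,4)]] by blast
  obtain t where t: "b \<sqinter> q \<sqsubseteq> t" "cg p q = cg t (b \<sqinter> q)"
    using transpose_to_bottom[OF C(3) meet_le2[OF C(2,4)]] by blast
  have "(s, b \<sqinter> q) \<in> cg p q"
    using cg_reflect_common_bottom[OF s(1) t(1)] v s(2) t(2) by (simp add: v_def)
  then have "cg a b \<subseteq> cg p q"
    unfolding s(2) by (rule cg_least[OF cg_in_Con[OF C(3,4)]])
  then show ?thesis using mem_cg by blast
qed

text \<open>Distributivity cuts \<open>v a b\<close> into a part below the first generator and a
  part below the rest. A point \<open>x\<close> between \<open>b\<close> and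
  \<open>a \<squnion> b\<close> realises the cut; \<open>cg_reflect\<close> handles one half and the
  induction hypothesis the other.\<close>

lemma cgen_reflect:
  assumes "finite R" "R \<subseteq> C \<times> C" "a \<in> C" "b \<in> C" "v a b \<le> \<phi> (cgen L R)"
  shows "(a, b) \<in> cgen L R"
  using assms
proof (induction R arbitrary: a b)
  case empty
  then have "v a b = bot" using con_c_hom_empty[OF prelattice hom] by (simp add: bot_unique)
  then show ?case
    using v_eq_bot_iff empty cgen_eq_ple[OF prelattice, of "{}"] by simp
next
  case (insert p R)
  let ?\<rho> = "cgen L (insert p R)"
  obtain p1 p2 where p: "p = (p1, p2)" by fastforce
  have C: "p1 \<in> C" "p2 \<in> C" "R \<subseteq> C \<times> C" using insert.prems p by auto
  have r: "?\<rho> \<in> Con L" using cgen_in_Con[OF prelattice insert.prems(1)] .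
  have "v a b \<le> sup (v p1 p2) (\<phi> (cgen L R))"
    using insert.prems(4) con_c_hom_insert[OF prelattice hom insert.hyps(1), of p] C
    by (simp add: p v_def)
  then have "v (a \<squnion> b) b = sup (inf (v a b) (v p1 p2)) (inf (v a b) (\<phi> (cgen L R)))"
    using v_join insert.prems by (simp add: inf_sup_distrib1[symmetric] inf_absorb1)
  then obtain x where x: "b \<sqsubseteq> x" "x \<sqsubseteq> a \<squnion> b"
      "v x b = inf (v a b) (v p1 p2)" "v (a \<squnion> b) x = inf (v a b) (\<phi> (cgen L R))"
    using split_interval[OF join_ge2] insert.prems by metis
  have xC: "x \<in> C" "a \<squnion> b \<in> C" using x le_carrier by auto
  have "(x, b) \<in> cg p1 p2"
    using cg_reflect xC C insert.prems x(3) by simp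
  then have "(x, b) \<in> ?\<rho>"
    using cgen_mono[of "{p}" "insert p R" L] p by auto
  moreover have "(a \<squnion> b, x) \<in> cgen L R"
    using insert.IH[OF C(3) xC(2,1)] x(4) by simp
  then have "(a \<squnion> b, x) \<in> ?\<rho>"
    using cgen_mono[of R "insert p R" L] by auto
  ultimately have "(a \<squnion> b, b) \<in> ?\<rho>" using Con_trans[OF r] by blast
  then show ?case
    using Con_trans[OF r Con_le[OF r join_ge1]] insert.prems by blast
qed

lemma Con_c_reflect:
  assumes r: "r \<in> Con_c L" and s: "s \<in> Con_c L" and le: "\<phi> r \<le> \<phi> s"
  shows "r \<subseteq> s"
proof
  fix p assume p: "p \<in> r"
  obtain S where S: "finite S" "S \<subseteq> C \<times> C" "s = cgen L S"
    using Con_cE[OF prelattice s] .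
  obtain a b where ab: "p = (a, b)" by fastforce
  have "r \<in> Con L" using r by (simp add: Con_c_def)
  then have C: "a \<in> C" "b \<in> C" using ConD(3) p ab by auto
  have "v a b \<le> \<phi> s" using v_le[OF r] p ab le order_trans by blast
  then show "p \<in> s" using cgen_reflect[OF S(1,2) C] S(3) ab by simp
qed

lemma inj_on_measure: "inj_on \<phi> (Con_c L)"
  by (intro inj_onI subset_antisym Con_c_reflect) simp_all

section \<open>The range of the measure\<close>

lemma measure_sup_closed:
  assumes "x \<in> \<phi> ` Con_c L" "y \<in> \<phi> ` Con_c L"
  shows "sup x y \<in> \<phi> ` Con_c L"
proof -
  obtain r s where rs: "r \<in> Con_c L" "s \<in> Con_c L" "x = \<phi> r" "y = \<phi> s"
    using assms by blast
  then have "sup x y = \<phi> (cgen L (r \<union> s))"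
    using hom by (simp add: con_c_hom_def)
  then show ?thesis
    using cgen_Un_in_Con_c[OF prelattice rs(1,2)] by simp
qed

text \<open>By distributivity an element below a finite join is the join of its parts below the
  terms. The part below \<open>v p1 p2\<close> is the measure of an initial segment of the interval
  from \<open>p2\<close> to \<open>p1 \<squnion> p2\<close>.\<close>

lemma measure_downward:
  assumes "finite R" "R \<subseteq> C \<times> C" "d \<le> \<phi> (cgen L R)"
  shows "d \<in> \<phi> ` Con_c L"
  using assms
proof (induction R arbitrary: d)
  case empty
  then have "d = \<phi> (cgen L {})"
    using con_c_hom_empty[OF prelattice hom] by (simp add: bot_unique)
  then show ?case using cgen_finite_in_Con_c[OF prelattice, of "{}"] by simp
next
  case (insert p R)
  obtain p1 p2 where p: "p = (p1, p2)" by fastforce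
  have C: "p1 \<in> C" "p2 \<in> C" "R \<subseteq> C \<times> C" using insert.prems p by auto
  have "d \<le> sup (v p1 p2) (\<phi> (cgen L R))"
    using insert.prems con_c_hom_insert[OF prelattice hom insert.hyps(1), of p] C
    by (simp add: p v_def)
  then have d: "d = sup (inf d (v p1 p2)) (inf d (\<phi> (cgen L R)))"
    by (simp add: inf_sup_distrib1[symmetric] inf_absorb1)
  have "v (p1 \<squnion> p2) p2 = sup (inf d (v p1 p2)) (v p1 p2)"
    using v_join C by (simp add: sup_absorb2)
  then obtain x where "p2 \<sqsubseteq> x" "v x p2 = inf d (v p1 p2)"
    using split_interval[OF join_ge2] C by metis
  then have 1: "inf d (v p1 p2) \<in> \<phi> ` Con_c L"
    using cg_in_Con_c le_carrier unfolding v_def by (metis imageI)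
  have 2: "inf d (\<phi> (cgen L R)) \<in> \<phi> ` Con_c L"
    using insert.IH C(3) by simp
  show ?case
    using measure_sup_closed[OF 1 2] d by simp
qed

lemma lattice_ideal_measure: "lattice_ideal (\<phi> ` Con_c L)"
  unfolding lattice_ideal_def
proof (intro conjI ballI allI impI)
  show "\<phi> ` Con_c L \<noteq> {}" using ple_in_Con_c[OF prelattice] by blast
  show "y \<in> \<phi> ` Con_c L" if x: "x \<in> \<phi> ` Con_c L" and y: "y \<le> x" for x y
  proof -
    obtain r where r: "r \<in> Con_c L" "x = \<phi> r" using x by blast
    obtain R where "finite R" "R \<subseteq> C \<times> C" "r = cgen L R" using Con_cE[OF prelattice r(1)] .
    then show ?thesis using measure_downward y r(2) by simp
  qed
  show "sup x y \<in> \<phi> ` Con_c L" if "x \<in> \<phi> ` Con_c L" "y \<in> \<phi> ` Con_c L" for x y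
    using that by (rule measure_sup_closed)
qed

lemma con_c_iso_image: "con_c_iso_onto L \<phi> (\<phi> ` Con_c L)"
  using hom inj_on_measure by (simp add: con_c_iso_onto_def bij_betw_def)

text \<open>Nonzero values are attained by extending a point to a two-element chain, upwards or
  downwards according to the saturation; \<open>bot\<close> is the measure of the order.\<close>

lemma con_c_iso_UNIV:
  assumes "lower_saturated L \<phi> \<or> upper_saturated L \<phi>"
  shows "con_c_iso_onto L \<phi> UNIV"
proof -
  have "\<exists>x\<in>C. \<exists>y\<in>C. v x y = d" if d: "d \<noteq> bot" for d
  proof (cases "lower_saturated L \<phi>")
    case True
    then show ?thesis
      unfolding lower_saturated_def
      by (rule attains_value[of _ "{0}"]) (simp_all add: fan_lower_map d)
  next
    case False
    then have "saturated_wrt upper_map L \<phi>"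
      using assms by (simp add: upper_saturated_def)
    then show ?thesis
      by (rule attains_value[of _ "{1}"]) (simp_all add: fan_upper_map d)
  qed
  then have "d \<in> \<phi> ` Con_c L" for d
    using cg_in_Con_c hom ple_in_Con_c[OF prelattice]
    unfolding con_c_hom_def v_def by (metis imageI)
  then have "\<phi> ` Con_c L = UNIV" by blast
  then show ?thesis using con_c_iso_image by simp
qed

lemma has_relative_complements: "relatively_complemented L"
  using complement by (force simp: relatively_complemented_def linterval_def le_carrier)

section \<open>Direct sums and perspectivity\<close>

text \<open>A complement \<open>a1\<close> of \<open>c\<close> in the interval from
  \<open>c2\<close> to \<open>a\<close> enlarges the second summand while \<open>c1\<close> stays;
  since \<open>a1\<close> meets \<open>c\<close> exactly in \<open>c2\<close>, it meets
  \<open>c1\<close> in \<open>u\<close>.\<close>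

lemma refine_decomposition:
  assumes ca: "c \<sqsubseteq> a" and c: "u \<sqsubseteq> c1" "u \<sqsubseteq> c2" "c1 \<sqinter> c2 = u" "c1 \<squnion> c2 = c"
  obtains a1 where "u \<sqsubseteq> a1" "a1 \<sqsubseteq> a" "c1 \<sqinter> a1 = u" "c1 \<squnion> a1 = a" "c \<sqinter> a1 = c2"
    "v a1 u = sup (v a c) (v c2 u)"
proof -
  have C: "c1 \<in> C" "c2 \<in> C" "c \<in> C" using c ca le_carrier by auto
  have c1c: "c1 \<sqsubseteq> c" and c2c: "c2 \<sqsubseteq> c" using join_ge1 join_ge2 C c(4) by auto
  obtain a1 where a1: "c2 \<sqsubseteq> a1" "a1 \<sqsubseteq> a" "c \<sqinter> a1 = c2" "c \<squnion> a1 = a"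
    using complement[OF c2c ca] by blast
  have a1C: "a1 \<in> C" using a1 le_carrier by blast
  have ua1: "u \<sqsubseteq> a1" using c(2) a1(1) by (rule le_trans)
  have "c1 \<sqinter> a1 \<sqsubseteq> c \<sqinter> a1"
    using meet_le1[OF C(1) a1C] meet_le2[OF C(1) a1C] c1c by (blast intro: meet_greatest le_trans)
  then have "c1 \<sqinter> a1 \<sqsubseteq> u"
    using meet_le1[OF C(1) a1C] meet_greatest a1(3) c(3) by metis
  then have 1: "c1 \<sqinter> a1 = u"
    using meet_greatest[OF c(1) ua1] le_antisym by blast
  have j: "c1 \<sqsubseteq> c1 \<squnion> a1" "a1 \<sqsubseteq> c1 \<squnion> a1" using join_ge1 join_ge2 C a1C by auto
  have "c \<sqsubseteq> c1 \<squnion> a1"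
    using join_least[OF j(1) le_trans[OF a1(1) j(2)]] c(4) by simp
  then have "a \<sqsubseteq> c1 \<squnion> a1" using join_least j(2) a1(4) by metis
  moreover have "c1 \<squnion> a1 \<sqsubseteq> a" using join_least le_trans[OF c1c ca] a1(2) by blast
  ultimately have 2: "c1 \<squnion> a1 = a" using le_antisym by blast
  \<comment> \<open>The interval from \<open>c2\<close> to \<open>a1\<close> transposes up to the
    one from \<open>c\<close> to \<open>a\<close>.\<close>
  have "v a1 c2 = v a c"
    using v_meet[OF a1C C(3)] v_join[OF a1C C(3)] a1(3,4) meet_comm join_comm by metis
  then have "v a1 u = sup (v a c) (v c2 u)"
    using v_chain[OF c(2) a1(1)] by simp
  then show ?thesis using that ua1 a1 1 2 by blast
qed

text \<open>A common complement serves as axis of the perspectivity.\<close>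

lemma perspective_inI:
  assumes C: "x \<in> C" "y \<in> C" and le: "x \<sqsubseteq> i" "y \<sqsubseteq> i" and m: "x \<sqinter> y = u" and v: "v x u = v y u"
  shows "perspective_in L u i x y"
proof -
  obtain z where z: "u \<sqsubseteq> z" "z \<sqsubseteq> x \<squnion> y" "z \<sqinter> x = u" "z \<sqinter> y = u"
      "z \<squnion> x = x \<squnion> y" "z \<squnion> y = x \<squnion> y"
    using common_complement[OF C] m v by metis
  have "z \<sqsubseteq> i" using z(2) join_least[OF le] by (rule le_trans)
  moreover have "u \<sqsubseteq> x" "u \<sqsubseteq> y" using m meet_le1[OF C] meet_le2[OF C] by auto
  ultimately show ?thesis
    unfolding perspective_in_def linterval_def
    using z le le_carrier C by (intro conjI bexI[of _ z]) simp_all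
qed

text \<open>Let \<open>c\<close> be the meet of \<open>a\<close> and \<open>b\<close>. Since measures are idempotent, \<open>c\<close> is a direct sum of two
  elements \<open>c1\<close> and \<open>c2\<close> with the same measure as \<open>c\<close>. Pairing \<open>c1\<close>, \<open>c2\<close> crosswise makes the
  remaining summands of \<open>a\<close> and \<open>b\<close> disjoint and of equal measure.\<close>

lemma decompose:
  assumes le: "u \<sqsubseteq> a" "a \<sqsubseteq> i" "u \<sqsubseteq> b" "b \<sqsubseteq> i" and eq: "v a u = v b u"
  shows "\<exists>a0 a1 b0 b1. direct_sum_in L u i a a0 a1 \<and> direct_sum_in L u i b b0 b1 \<and>
    perspective_in L u i a0 b0 \<and> perspective_in L u i a1 b1"
proof -
  have C: "a \<in> C" "b \<in> C" using le le_carrier by auto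
  define c where "c = a \<sqinter> b"
  have uc: "u \<sqsubseteq> c" and ca: "c \<sqsubseteq> a" and cb: "c \<sqsubseteq> b"
    using meet_greatest[OF le(1,3)] meet_le1 meet_le2 C by (auto simp: c_def)
  have "v c u = sup (v c u) (v c u)" by simp
  then obtain c1 where c1: "u \<sqsubseteq> c1" "c1 \<sqsubseteq> c" "v c1 u = v c u" "v c c1 = v c u"
    using split_interval[OF uc] by metis
  obtain c2 where c2: "u \<sqsubseteq> c2" "c2 \<sqsubseteq> c" "c1 \<sqinter> c2 = u" "c1 \<squnion> c2 = c"
    using complement[OF c1(1,2)] by blast
  have cC: "c1 \<in> C" "c2 \<in> C" using c1 c2 le_carrier by auto
  have "v c2 u = v c c1"
    using v_meet[OF cC(2,1)] v_join[OF cC(2,1)] c2(3,4) meet_comm join_comm by metis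
  then have vc: "v c2 u = v c u" using c1(4) by simp
  \<comment> \<open>Crosswise extension: here \<open>c2\<close> grows while \<open>c1\<close> is
    kept; for \<open>b\<close> below, \<open>c1\<close> grows and \<open>c2\<close> is kept.\<close>
  obtain a1 where a1: "u \<sqsubseteq> a1" "a1 \<sqsubseteq> a" "c1 \<sqinter> a1 = u" "c1 \<squnion> a1 = a" "c \<sqinter> a1 = c2"
      "v a1 u = sup (v a c) (v c2 u)"
    using refine_decomposition[OF ca c1(1) c2(1,3,4)] .
  have c2': "c2 \<sqinter> c1 = u" "c2 \<squnion> c1 = c" using c2(3,4) meet_comm join_comm by metis+
  obtain b1 where b1: "u \<sqsubseteq> b1" "b1 \<sqsubseteq> b" "c2 \<sqinter> b1 = u" "c2 \<squnion> b1 = b" "c \<sqinter> b1 = c1"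
      "v b1 u = sup (v b c) (v c1 u)"
    using refine_decomposition[OF cb c2(1) c1(1) c2'] .
  have "v a1 u = v a u" "v b1 u = v b u"
    using a1(6) b1(6) vc c1(3) v_chain[OF uc ca] v_chain[OF uc cb] by simp_all
  then have v1: "v a1 u = v b1 u" using eq by simp
  have C1: "a1 \<in> C" "b1 \<in> C" using a1 b1 le_carrier by auto
  have m: "a1 \<sqinter> b1 \<sqsubseteq> a1" "a1 \<sqinter> b1 \<sqsubseteq> b1" using meet_le1 meet_le2 C1 by auto
  have mc: "a1 \<sqinter> b1 \<sqsubseteq> c"
    unfolding c_def using m a1(2) b1(2) by (blast intro: meet_greatest le_trans)
  \<comment> \<open>Being below \<open>c\<close>, this meet lies below
    \<open>c \<sqinter> a1 = c2\<close> and \<open>c \<sqinter> b1 = c1\<close>, which are disjoint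
    over \<open>u\<close>.\<close>
  have "a1 \<sqinter> b1 \<sqsubseteq> u"
    using meet_greatest[OF mc m(1)] meet_greatest[OF mc m(2)] meet_greatest a1(5) b1(5) c2(3) by metis
  then have ab: "a1 \<sqinter> b1 = u" using meet_greatest[OF a1(1) b1(1)] le_antisym by blast
  have top: "c1 \<sqsubseteq> i" "c2 \<sqsubseteq> i" "a1 \<sqsubseteq> i" "b1 \<sqsubseteq> i"
    using c1(2) c2(2) ca a1(2) b1(2) le le_trans by blast+
  have "direct_sum_in L u i a c1 a1" "direct_sum_in L u i b c2 b1"
    using a1 b1 c1 c2 top cC C1 by (simp_all add: direct_sum_in_def linterval_def)
  moreover have "perspective_in L u i c1 c2" "perspective_in L u i a1 b1"
    using perspective_inI[OF cC top(1,2) c2(3)] perspective_inI[OF C1 top(3,4) ab v1] c1(3) vc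
    by simp_all
  ultimately show ?thesis by blast
qed

text \<open>A congruence puts a direct sum below \<open>u\<close> exactly when it does so with both
  summands, and perspectivity carries this from one summand to its partner.\<close>

lemma cg_eq_of_decomposition:
  assumes a: "direct_sum_in L u i a a0 a1" and b: "direct_sum_in L u i b b0 b1"
    and p: "perspective_in L u i a0 b0" "perspective_in L u i a1 b1"
  shows "cg a u = cg b u"
proof (rule cg_eqI)
  fix r assume r: "r \<in> Con L"
  have sum: "(c, u) \<in> r \<longleftrightarrow> (c0, u) \<in> r \<and> (c1, u) \<in> r"
    if "direct_sum_in L u i c c0 c1" for c c0 c1
  proof -
    have C: "c0 \<in> C" "c1 \<in> C" and c: "c0 \<squnion> c1 = c"
      using that by (auto simp: direct_sum_in_def linterval_def)
    then have "c0 \<sqsubseteq> c" "c1 \<sqsubseteq> c" using join_ge1 join_ge2 by auto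
    then show ?thesis
      using Con_join[OF r] Con_trans[OF r] Con_le[OF r] c by blast
  qed
  have persp: "(x, u) \<in> r \<longleftrightarrow> (y, u) \<in> r" if xy: "perspective_in L u i x y" for x y
  proof -
    obtain z where z: "u \<sqsubseteq> z" "x \<in> C" "y \<in> C" "z \<sqinter> x = z \<sqinter> y" "z \<squnion> x = z \<squnion> y"
      using xy by (auto simp: perspective_in_def linterval_def)
    show ?thesis
      using perspective_Con[OF r z] perspective_Con[OF r z(1,3,2) z(4,5)[symmetric]] by (rule iffI)
  qed
  show "(a, u) \<in> r \<longleftrightarrow> (b, u) \<in> r"
    using sum[OF a] sum[OF b] persp[OF p(1)] persp[OF p(2)] by blast
qed

lemma Theta_eq_iff:
  assumes le: "u \<sqsubseteq> a" "a \<sqsubseteq> i" "u \<sqsubseteq> b" "b \<sqsubseteq> i"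
  shows "Theta L u a = Theta L u b \<longleftrightarrow>
    (\<exists>a0\<in>linterval L u i. \<exists>a1\<in>linterval L u i. \<exists>b0\<in>linterval L u i. \<exists>b1\<in>linterval L u i.
       direct_sum_in L u i a a0 a1 \<and> direct_sum_in L u i b b0 b1 \<and>
       perspective_in L u i a0 b0 \<and> perspective_in L u i a1 b1)" (is "_ \<longleftrightarrow> ?dec")
proof
  assume "Theta L u a = Theta L u b"
  then have "v a u = v b u" using Theta_cg le by (simp add: v_def)
  from decompose[OF le this] show ?dec
    unfolding direct_sum_in_def by blast
next
  assume ?dec
  then have "cg a u = cg b u" using cg_eq_of_decomposition by blast
  then show "Theta L u a = Theta L u b" using Theta_cg le by simp
qed

end

theorem proposition20p8:
  fixes L :: "'a plat"
    and \<phi> :: "'a rel \<Rightarrow> 'd::{distrib_lattice, order_bot}"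
  assumes "internally_saturated L \<phi>"
  shows "relatively_complemented L \<and>
    (\<exists>I. lattice_ideal I \<and> con_c_iso_onto L \<phi> I) \<and>
    (\<forall>u\<in>pcarrier L. \<forall>a\<in>pcarrier L. \<forall>b\<in>pcarrier L. \<forall>i\<in>pcarrier L.
       (u, a) \<in> ple L \<and> (a, i) \<in> ple L \<and> (u, b) \<in> ple L \<and> (b, i) \<in> ple L \<longrightarrow>
       (Theta L u a = Theta L u b \<longleftrightarrow>
        (\<exists>a0\<in>linterval L u i. \<exists>a1\<in>linterval L u i.
         \<exists>b0\<in>linterval L u i. \<exists>b1\<in>linterval L u i.
           direct_sum_in L u i a a0 a1 \<and> direct_sum_in L u i b b0 b1 \<and>
           perspective_in L u i a0 b0 \<and> perspective_in L u i a1 b1))) \<and>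
    (lower_saturated L \<phi> \<or> upper_saturated L \<phi> \<longrightarrow> con_c_iso_onto L \<phi> UNIV)"
proof -
  interpret internally_saturated_lat L \<phi>
  proof
    show sat: "saturated_wrt internal_map L \<phi>"
      using assms by (simp add: internally_saturated_def)
    then show "total_lattice L" "con_c_hom L \<phi>" "proper_measure L \<phi>"
      by (simp_all add: saturated_wrt_def measured_plat_def)
  qed
  show ?thesis
    using has_relative_complements lattice_ideal_measure con_c_iso_image Theta_eq_iff con_c_iso_UNIV
    by blast
qed

end
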